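(* Let $u\in G[0,1]$, $\beta\in\mathbb R$, $\eta\in[0,1]$, and let $f,g:[0,1]\times\mathbb R\to\mathbb R$ satisfy the following assumptions. (H1) For every $x\in G[0,1]$ the function $t\mapsto f(t,x(t))$ is Kurzweil--Henstock integrable on $[0,1]$. (H2) For every $t\in[0,1]$ the function $f(t,\cdot)$ is continuous on $\mathbb R$. (H3) There exist nonnegative Kurzweil--Henstock integrable functions $k,h:[0,1]\to\mathbb R$ such that for every $r>0$, every $x\in B_r$ and every $t\in[0,1]$, $$-k(t)\|x\|-h(t)\le f(t,x(t))\le k(t)\|x\|+h(t).$$ (H4) For every $x\in G[0,1]$ the function $t\mapsto g(t,x(t))$ is of bounded variation on $[0,1]$, and $g(0,x(0))=0$. (H5) For every $t\in[0,1]$ the function $g(t,\cdot)$ is continuous on $\mathbb R$. (H6) There exists $M>0$ such that for every $r>0$ and every $x\in B_r$ the total variation on $[0,1]$ of $t\mapsto g(t,x(t))$ is at most $M$. Suppose that, with $k$ the function in (H3), $$(|\beta|+2)\max_{t\in[0,1]}\left|\int_0^t k(s)\,ds\right|<1 .$$ Then the boundary value problem $$-D^2x=f(t,x)+g(t,x)Du\quad\text{on }[0,1],\qquad x(0)=\beta\,Dx(0),\qquad Dx(1)+Dx(\eta)=0,$$ has at least one solution $x\in G[0,1]$.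
   Context: $G[0,1]$ is the space of real regulated functions on $[0,1]$ (functions all of whose one-sided limits exist and are finite at every point of $[0,1]$), with the supremum norm $\|x\|=\sup_{t\in[0,1]}|x(t)|$. For $r>0$, $B_r=\{x\in G[0,1]:\|x\|\le r\}$. The total variation of $v:[0,1]\to\mathbb R$ is $\sup\sum_n|v(s_n)-v(t_n)|$ over all sequences $\{(t_n,s_n)\}$ of disjoint intervals in $[0,1]$. Kurzweil--Henstock--Stieltjes integral: for $v,u:[a,b]\to\mathbb R$, $\int_a^b v\,du=I$ means that for every $\varepsilon>0$ there is a function $\delta:[a,b]\to(0,\infty)$ such that $\left|\sum_{i=1}^m v(\xi_i)(u(t_i)-u(t_{i-1}))-I\right|<\varepsilon$ for every partition $a=t_0<t_1<\dots<t_m=b$ with tags $\xi_i\in[t_{i-1},t_i]$ satisfying $[t_{i-1},t_i]\subset(\xi_i-\delta(\xi_i),\xi_i+\delta(\xi_i))$ for all $i$. With $u(t)=t$ this is the Kurzweil--Henstock integral. The integral of a function of bounded variation against a regulated function exists in this sense. $D$ denotes the distributional derivative. The equation is understood in its once-integrated form. For $x\in G[0,1]$ put $F(t,x)=\int_0^t f(s,x(s))\,ds$ and $G_u(t,x)=\int_0^t g(s,x(s))\,du(s)$ for $t\in[0,1]$. A solution of the boundary value problem is a function $x\in G[0,1]$ for which there is a regulated function, denoted $Dx:[0,1]\to\mathbb R$, such that for all $t\in[0,1]$ $$x(t)=x(0)+\int_0^t Dx(s)\,ds,\qquad Dx(t)=Dx(0)-F(t,x)-G_u(t,x),$$ and such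 that $x(0)=\beta Dx(0)$ and $Dx(1)+Dx(\eta)=0$ hold with these pointwise values of $Dx$. *)

theory Defs
  imports "HOL-Analysis.Analysis"
begin

text \<open>Functions on an interval are total functions on the reals; nothing below depends on
  their values outside the interval.\<close>

definition regulated_on :: "real \<Rightarrow> real \<Rightarrow> (real \<Rightarrow> real) \<Rightarrow> bool" where
  "regulated_on a b x \<longleftrightarrow>
     (\<forall>t\<in>{a..<b}. \<exists>l. (x \<longlongrightarrow> l) (at_right t)) \<and>
     (\<forall>t\<in>{a<..b}. \<exists>l. (x \<longlongrightarrow> l) (at_left t))"

text \<open>A regulated function on a compact interval is bounded, so the real supremum below is the
  genuine one for members of \<open>G01\<close>.\<close>

definition G01 :: "(real \<Rightarrow> real) set" where
  "G01 = {x. regulated_on 0 1 x}"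

definition supnorm :: "(real \<Rightarrow> real) \<Rightarrow> real" where
  "supnorm x = (SUP t\<in>{0..1}. \<bar>x t\<bar>)"

definition B :: "real \<Rightarrow> (real \<Rightarrow> real) set" where
  "B r = {x \<in> G01. supnorm x \<le> r}"

text \<open>The intervals \<open>(t n, s n)\<close> may be empty (\<open>t n = s n\<close>); such intervals contribute 0,
  so finite families of intervals are included.\<close>

definition total_variation :: "real \<Rightarrow> real \<Rightarrow> (real \<Rightarrow> real) \<Rightarrow> ennreal" where
  "total_variation a b v =
     (SUP (t, s) \<in> {(t, s). (\<forall>n::nat. a \<le> t n \<and> t n \<le> s n \<and> s n \<le> b) \<and>
                             disjoint_family (\<lambda>n. {t n<..<s n})}.
        \<Sum>n. ennreal \<bar>v (s n) - v (t n)\<bar>)"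

definition bounded_variation :: "real \<Rightarrow> real \<Rightarrow> (real \<Rightarrow> real) \<Rightarrow> bool" where
  "bounded_variation a b v \<longleftrightarrow> total_variation a b v < \<infinity>"

text \<open>The Kurzweil--Henstock--Stieltjes integral of \<open>v\<close> against \<open>u\<close> over \<open>[a, b]\<close>, \<open>a \<le> b\<close>. For
  \<open>a = b\<close> the only partition has no subinterval, and the integral is 0. The case \<open>u t = t\<close> is
  the library's \<open>has_integral\<close>, which is used for the Kurzweil--Henstock integral.\<close>

definition tagged_partition ::
    "real \<Rightarrow> real \<Rightarrow> nat \<Rightarrow> (nat \<Rightarrow> real) \<Rightarrow> (nat \<Rightarrow> real) \<Rightarrow> bool" where
  "tagged_partition a b m t \<xi> \<longleftrightarrow>
     t 0 = a \<and> t m = b \<and>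
     (\<forall>i\<in>{1..m}. t (i - 1) < t i \<and> \<xi> i \<in> {t (i - 1)..t i})"

definition has_KHS_integral ::
    "(real \<Rightarrow> real) \<Rightarrow> (real \<Rightarrow> real) \<Rightarrow> real \<Rightarrow> real \<Rightarrow> real \<Rightarrow> bool" where
  "has_KHS_integral v u a b I \<longleftrightarrow>
     (\<forall>\<epsilon>>0. \<exists>\<delta> :: real \<Rightarrow> real. (\<forall>s\<in>{a..b}. \<delta> s > 0) \<and>
        (\<forall>m t \<xi>. tagged_partition a b m t \<xi> \<and>
            (\<forall>i\<in>{1..m}. {t (i - 1)..t i} \<subseteq> {\<xi> i - \<delta> (\<xi> i)<..<\<xi> i + \<delta> (\<xi> i)}) \<longrightarrow>
            \<bar>(\<Sum>i=1..m. v (\<xi> i) * (u (t i) - u (t (i - 1)))) - I\<bar> < \<epsilon>))"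

definition KHS_integrable :: "(real \<Rightarrow> real) \<Rightarrow> (real \<Rightarrow> real) \<Rightarrow> real \<Rightarrow> real \<Rightarrow> bool" where
  "KHS_integrable v u a b \<longleftrightarrow> (\<exists>I. has_KHS_integral v u a b I)"

definition KHS_integral :: "(real \<Rightarrow> real) \<Rightarrow> (real \<Rightarrow> real) \<Rightarrow> real \<Rightarrow> real \<Rightarrow> real" where
  "KHS_integral v u a b = (SOME I. has_KHS_integral v u a b I)"

definition F_int :: "(real \<Rightarrow> real \<Rightarrow> real) \<Rightarrow> real \<Rightarrow> (real \<Rightarrow> real) \<Rightarrow> real" where
  "F_int f t x = integral {0..t} (\<lambda>s. f s (x s))"

definition G_int ::
    "(real \<Rightarrow> real \<Rightarrow> real) \<Rightarrow> (real \<Rightarrow> real) \<Rightarrow> real \<Rightarrow> (real \<Rightarrow> real) \<Rightarrow> real" where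
  "G_int g u t x = KHS_integral (\<lambda>s. g s (x s)) u 0 t"

text \<open>Integrability is demanded explicitly because the integral operators are total; the function
  \<open>Dx\<close> is regulated and hence integrable.\<close>

definition bvp_solution ::
    "(real \<Rightarrow> real \<Rightarrow> real) \<Rightarrow> (real \<Rightarrow> real \<Rightarrow> real) \<Rightarrow> (real \<Rightarrow> real) \<Rightarrow> real \<Rightarrow> real \<Rightarrow>
     (real \<Rightarrow> real) \<Rightarrow> bool" where
  "bvp_solution f g u \<beta> \<eta> x \<longleftrightarrow>
     x \<in> G01 \<and>
     (\<forall>t\<in>{0..1}. (\<lambda>s. f s (x s)) integrable_on {0..t} \<and> KHS_integrable (\<lambda>s. g s (x s)) u 0 t) \<and>
     (\<exists>Dx \<in> G01.
        (\<forall>t\<in>{0..1}. x t = x 0 + integral {0..t} Dx \<and>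
                     Dx t = Dx 0 - F_int f t x - G_int g u t x) \<and>
        x 0 = \<beta> * Dx 0 \<and> Dx 1 + Dx \<eta> = 0)"

end

theory Submission
  imports Defs "HOL-Complex_Analysis.Great_Picard"
begin

text \<open>With \<open>N(t, x) = F(t, x) + G\<^sub>u(t, x)\<close>, the problem is to find \<open>x\<close> and \<open>c = Dx(0)\<close> such that
  \<open>x(t) = \<beta> c + \<integral>\<^sub>0\<^sup>t (c - N(s, x)) ds\<close> and \<open>2 c = N(1, x) + N(\<eta>, x)\<close>. Since \<open>N(t, x)\<close> depends only on
  the values of \<open>x\<close> on \<open>[0, t]\<close>, Tonelli's delay replaces the Schauder fixed point theorem: with the
  upper limit \<open>t\<close> of the integral lowered by \<open>\<delta>\<close>, finitely many iterations produce for each \<open>c\<close> an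
  exact solution depending continuously on \<open>c\<close>. The boundary condition for \<open>c\<close> is then met by the
  intermediate value theorem, and the smallness of \<open>k\<close> bounds \<open>c\<close> and \<open>x\<close> uniformly in \<open>\<delta>\<close>. The
  solutions are equi-Lipschitz, so the Arzela--Ascoli theorem yields a limit as \<open>\<delta>\<close> tends to 0.

  The operator \<open>N\<close> is continuous under pointwise convergence of uniformly bounded functions: for \<open>F\<close>
  by dominated convergence, for \<open>G\<^sub>u\<close> because a regulated \<open>u\<close> is a uniform limit of step functions,
  against which the integral is a finite combination of values of the integrand, while summation by
  parts bounds the error by the variation of the integrand times the uniform distance.\<close>

section \<open>Variation and Riemann--Stieltjes sums\<close>

text \<open>\<open>total_variation\<close> ranges over infinite sequences of intervals. Freezing the
  chain at index \<open>m\<close> produces such a sequence, whose later intervals are empty and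
  contribute 0. Weak monotonicity allows the points to be tags, which may coincide.\<close>

lemma sum_abs_diff_le_total_variation:
  fixes p :: "nat \<Rightarrow> real" and v :: "real \<Rightarrow> real"
  assumes mono: "\<And>i. i < m \<Longrightarrow> p i \<le> p (Suc i)" and "a \<le> p 0" "p m \<le> b"
    and M: "total_variation a b v \<le> ennreal M" "0 \<le> M"
  shows "(\<Sum>i<m. \<bar>v (p (Suc i)) - v (p i)\<bar>) \<le> M"
proof -
  define t where "t n = p (min n m)" for n
  have tm: "t i \<le> t j" if "i \<le> j" for i j
    using that
  proof (rule lift_Suc_mono_le[rotated])
    show "t n \<le> t (Suc n)" for n
      using mono[of n] by (cases "n < m") (auto simp: t_def min_def)
  qed
  have t0: "a \<le> t n" "t n \<le> b" for n
    using tm[of 0 n] tm[of n "max n m"] assms(2,3) by (auto simp: t_def)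
  have disj: "disjoint_family (\<lambda>n. {t n<..<t (Suc n)})"
    unfolding disjoint_family_on_def
  proof (intro ballI impI)
    fix i j :: nat assume "i \<noteq> j"
    then consider "Suc i \<le> j" | "Suc j \<le> i" by linarith
    then show "{t i<..<t (Suc i)} \<inter> {t j<..<t (Suc j)} = {}"
    proof cases
      case 1 then show ?thesis using tm[OF 1] by auto
    next
      case 2 then show ?thesis using tm[OF 2] by auto
    qed
  qed
  have "ennreal (\<Sum>i<m. \<bar>v (p (Suc i)) - v (p i)\<bar>) = (\<Sum>i<m. ennreal \<bar>v (t (Suc i)) - v (t i)\<bar>)"
    by (subst sum_ennreal[symmetric]) (auto simp: t_def)
  also have "\<dots> = (\<Sum>n. ennreal \<bar>v (t (Suc n)) - v (t n)\<bar>)"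
    by (rule suminf_finite[symmetric]) (auto simp: t_def)
  also have "\<dots> \<le> total_variation a b v"
    unfolding total_variation_def
    by (rule SUP_upper2[where i = "(t, \<lambda>n. t (Suc n))"]) (use t0 tm disj in auto)
  also note M(1)
  finally show ?thesis using M(2) by simp
qed

text \<open>A chain with the single interval from \<open>a\<close> to \<open>t\<close>: as
  \<open>v a = 0\<close>, its increment is \<open>v t\<close>.\<close>

lemma abs_le_total_variation:
  assumes "total_variation a b v \<le> ennreal M" "0 \<le> M" "v a = 0" "t \<in> {a..b}"
  shows "\<bar>v t\<bar> \<le> M"
  using sum_abs_diff_le_total_variation[of 1 "\<lambda>i. if i = 0 then a else t" a b v M] assms by simp

section \<open>Tagged partitions and summation by parts\<close>

lemma tagged_partition_mono:
  assumes "tagged_partition a b m t \<xi>" "i \<le> j" "j \<le> m"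
  shows "t i \<le> t j"
  using assms(2,3)
proof (induction rule: dec_induct)
  case (step n)
  then have "Suc n \<in> {1..m}" using assms(3) by simp
  then have "t (Suc n - 1) < t (Suc n)"
    using assms(1) unfolding tagged_partition_def by blast
  with step show ?case by simp
qed simp

lemma tagged_partition_point:
  assumes "tagged_partition a b m t \<xi>" "i \<le> m"
  shows "t i \<in> {a..b}"
  using tagged_partition_mono[OF assms(1), of 0 i] tagged_partition_mono[OF assms(1), of i m]
    assms by (auto simp: tagged_partition_def)

lemma tagged_partition_tag:
  assumes "tagged_partition a b m t \<xi>" "i \<in> {1..m}"
  shows "\<xi> i \<in> {t (i - 1)..t i}" "\<xi> i \<in> {a..b}"
proof -
  show *: "\<xi> i \<in> {t (i - 1)..t i}"
    using assms unfolding tagged_partition_def by auto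
  have "i \<le> m" "i - 1 \<le> m" using assms(2) by auto
  then have "t i \<in> {a..b}" "t (i - 1) \<in> {a..b}"
    using tagged_partition_point[OF assms(1)] by blast+
  then show "\<xi> i \<in> {a..b}"
    using * unfolding atLeastAtMost_iff by linarith
qed

text \<open>Abel summation, moving the differences from the values \<open>w\<close> at the division
  points to the values \<open>v\<close> at the tags. Tags are numbered from 1, division points from
  0.\<close>

lemma sum_by_parts_tagged:
  fixes v w :: "nat \<Rightarrow> real"
  shows "(\<Sum>i=1..Suc n. v i * (w i - w (i - 1))) =
    v (Suc n) * w (Suc n) - v 1 * w 0 - (\<Sum>i<n. (v (Suc (Suc i)) - v (Suc i)) * w (Suc i))"
  by (induction n) (auto simp: algebra_simps)

text \<open>Summation by parts leaves two boundary terms and a sum weighted by the increments of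
  \<open>v\<close> along the tags. Each is at most \<open>M * \<bar>W\<bar>\<close>, whence the
  factor 3. No gauge enters, so the bound is uniform over all tagged partitions.\<close>

lemma riemann_sum_bound:
  assumes P: "tagged_partition a b m t \<xi>" and sub: "{a..b} \<subseteq> {c..d}"
    and M: "total_variation c d v \<le> ennreal M" "0 \<le> M" "v c = 0"
    and W: "\<And>s. s \<in> {a..b} \<Longrightarrow> \<bar>w s\<bar> \<le> W"
  shows "\<bar>\<Sum>i=1..m. v (\<xi> i) * (w (t i) - w (t (i - 1)))\<bar> \<le> 3 * M * \<bar>W\<bar>"
proof (cases m)
  case 0
  then show ?thesis using M by simp
next
  case (Suc n)
  have W': "\<bar>w (t i)\<bar> \<le> \<bar>W\<bar>" if "i \<le> m" for i
    using W[OF tagged_partition_point[OF P that]] by simp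
  have tag: "\<xi> (Suc i) \<in> {t i..t (Suc i)}" if "i \<le> n" for i
    using tagged_partition_tag(1)[OF P, of "Suc i"] that Suc by simp
  have cd: "\<xi> (Suc i) \<in> {c..d}" if "i \<le> n" for i
    using tagged_partition_tag(2)[OF P, of "Suc i"] that Suc sub by auto
  have V: "\<bar>v (\<xi> (Suc i))\<bar> \<le> M" if "i \<le> n" for i
    by (rule abs_le_total_variation[OF M cd[OF that]])
  let ?p = "\<lambda>i. \<xi> (Suc i)"
  have var: "(\<Sum>i<n. \<bar>v (?p (Suc i)) - v (?p i)\<bar>) \<le> M"
  proof (rule sum_abs_diff_le_total_variation[OF _ _ _ M(1,2)])
    \<comment> \<open>Consecutive tags are separated by the division point
      \<open>t (Suc i)\<close>.\<close>
    show "?p i \<le> ?p (Suc i)" if "i < n" for i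
      using tag[of i] tag[of "Suc i"] that by auto
  qed (use cd[of 0] cd[of n] in auto)
  have "\<bar>\<Sum>i<n. (v (?p (Suc i)) - v (?p i)) * w (t (Suc i))\<bar>
      \<le> (\<Sum>i<n. \<bar>v (?p (Suc i)) - v (?p i)\<bar> * \<bar>W\<bar>)"
    by (rule order_trans[OF sum_abs sum_mono]) (use W' Suc in \<open>auto simp: abs_mult mult_left_mono\<close>)
  also have "\<dots> \<le> M * \<bar>W\<bar>"
    unfolding sum_distrib_right[symmetric] using var by (simp add: mult_right_mono)
  finally have 1: "\<bar>\<Sum>i<n. (v (?p (Suc i)) - v (?p i)) * w (t (Suc i))\<bar> \<le> M * \<bar>W\<bar>" .
  have 2: "\<bar>v (\<xi> (Suc n)) * w (t (Suc n))\<bar> \<le> M * \<bar>W\<bar>" "\<bar>v (\<xi> 1) * w (t 0)\<bar> \<le> M * \<bar>W\<bar>"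
    using V[of n] V[of 0] W'[of "Suc n"] W'[of 0] Suc M(2) by (auto simp: abs_mult intro!: mult_mono)
  have "(\<Sum>i=1..m. v (\<xi> i) * (w (t i) - w (t (i - 1)))) = v (\<xi> (Suc n)) * w (t (Suc n)) - v (\<xi> 1) * w (t 0)
      - (\<Sum>i<n. (v (?p (Suc i)) - v (?p i)) * w (t (Suc i)))"
    using sum_by_parts_tagged[of "\<lambda>i. v (\<xi> i)" "\<lambda>i. w (t i)" n] Suc by simp
  with 1 2 show ?thesis by linarith
qed

section \<open>The Kurzweil--Henstock--Stieltjes integral\<close>

text \<open>The gauge condition that is written inline in \<open>has_KHS_integral_def\<close>,
  isolated so that gauges can be combined.\<close>

definition tag_fine :: "(real \<Rightarrow> real) \<Rightarrow> nat \<Rightarrow> (nat \<Rightarrow> real) \<Rightarrow> (nat \<Rightarrow> real) \<Rightarrow> bool" where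
  "tag_fine \<delta> m t \<xi> \<longleftrightarrow> (\<forall>i\<in>{1..m}. {t (i - 1)..t i} \<subseteq> {\<xi> i - \<delta> (\<xi> i)<..<\<xi> i + \<delta> (\<xi> i)})"

lemma tag_fine_min:
  "tag_fine (\<lambda>s. min (\<delta> s) (\<delta>' s)) m t \<xi> \<longleftrightarrow> tag_fine \<delta> m t \<xi> \<and> tag_fine \<delta>' m t \<xi>"
proof -
  have "tag_fine \<delta> m t \<xi> \<longleftrightarrow> (\<forall>i\<in>{1..m}. \<forall>s\<in>{t (i - 1)..t i}. \<bar>s - \<xi> i\<bar> < \<delta> (\<xi> i))" for \<delta>
    unfolding tag_fine_def subset_eq by (intro ball_cong refl) (auto simp: abs_less_iff)
  then show ?thesis by (simp add: ball_conj_distrib)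
qed

text \<open>Cousin's lemma, by the bisection principle \<open>Bolzano\<close>: fine partitions of
  adjacent intervals concatenate, and an interval around \<open>x\<close> shorter than
  \<open>\<delta> x\<close> is fine when tagged by \<open>x\<close> alone.\<close>

lemma tag_fine_partition_exists:
  fixes a b :: real
  assumes "a \<le> b" and pos: "\<And>s. s \<in> {a..b} \<Longrightarrow> \<delta> s > 0"
  shows "\<exists>m t \<xi>. tagged_partition a b m t \<xi> \<and> tag_fine \<delta> m t \<xi>"
  using assms(1)
proof (rule Bolzano)
  fix a b c :: real
  assume "\<exists>m t \<xi>. tagged_partition a b m t \<xi> \<and> tag_fine \<delta> m t \<xi>"
    and "\<exists>m t \<xi>. tagged_partition b c m t \<xi> \<and> tag_fine \<delta> m t \<xi>"
  then obtain m t \<xi> m' t' \<xi>' where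
    1: "tagged_partition a b m t \<xi>" "tag_fine \<delta> m t \<xi>" and
    2: "tagged_partition b c m' t' \<xi>'" "tag_fine \<delta> m' t' \<xi>'" by blast
  \<comment> \<open>The node with index \<open>m\<close> is shared: the first subinterval taken from
    the second partition has index \<open>Suc m\<close> and left end
    \<open>t m = t' 0\<close>.\<close>
  let ?t = "\<lambda>i. if i \<le> m then t i else t' (i - m)"
  let ?\<xi> = "\<lambda>i. if i \<le> m then \<xi> i else \<xi>' (i - m)"
  have t': "t m = t' 0"
    using 1 2 by (auto simp: tagged_partition_def)
  have eq: "?t (i - 1) = t' (i - m - 1)" "?t i = t' (i - m)" "?\<xi> i = \<xi>' (i - m)" "i - m \<in> {1..m'}"
    if "i \<in> {1..m + m'}" "\<not> i \<le> m" for i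
  proof -
    show "?t (i - 1) = t' (i - m - 1)"
    proof (cases "i = Suc m")
      case False
      with that have "\<not> i - 1 \<le> m" "i - 1 - m = i - m - 1" by auto
      then show ?thesis by (simp del: One_nat_def)
    qed (simp add: t')
  qed (use that in auto)
  have eq': "?t (i - 1) = t (i - 1)" "?t i = t i" "?\<xi> i = \<xi> i" "i \<in> {1..m}"
    if "i \<in> {1..m + m'}" "i \<le> m" for i
    using that by auto
  have "tagged_partition a c (m + m') ?t ?\<xi>"
    unfolding tagged_partition_def
  proof (intro conjI ballI)
    fix i assume i: "i \<in> {1..m + m'}"
    show "?t (i - 1) < ?t i" "?\<xi> i \<in> {?t (i - 1)..?t i}"
      unfolding atomize_conj
    proof (cases "i \<le> m")
      case True
      then show "?t (i - 1) < ?t i \<and> ?\<xi> i \<in> {?t (i - 1)..?t i}"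
        unfolding eq'(1-3)[OF i True] using 1(1) eq'(4)[OF i True] unfolding tagged_partition_def by blast
    next
      case False
      then show "?t (i - 1) < ?t i \<and> ?\<xi> i \<in> {?t (i - 1)..?t i}"
        unfolding eq(1-3)[OF i False] using 2(1) eq(4)[OF i False] unfolding tagged_partition_def by blast
    qed
  qed (use 1 2 in \<open>auto simp: tagged_partition_def\<close>)
  moreover have "tag_fine \<delta> (m + m') ?t ?\<xi>"
    unfolding tag_fine_def
  proof
    fix i assume i: "i \<in> {1..m + m'}"
    show "{?t (i - 1)..?t i} \<subseteq> {?\<xi> i - \<delta> (?\<xi> i)<..<?\<xi> i + \<delta> (?\<xi> i)}"
    proof (cases "i \<le> m")
      case True
      show ?thesis
        unfolding eq'(1-3)[OF i True] using 1(2) eq'(4)[OF i True] unfolding tag_fine_def by blast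
    next
      case False
      show ?thesis
        unfolding eq(1-3)[OF i False] using 2(2) eq(4)[OF i False] unfolding tag_fine_def by blast
    qed
  qed
  ultimately show "\<exists>m t \<xi>. tagged_partition a c m t \<xi> \<and> tag_fine \<delta> m t \<xi>" by blast
next
  fix x assume x: "a \<le> x" "x \<le> b"
  have "\<exists>m t \<xi>. tagged_partition c d m t \<xi> \<and> tag_fine \<delta> m t \<xi>" if "c \<le> x" "x \<le> d" "d - c < \<delta> x" for c d
  \<comment> \<open>Nodes increase strictly, so a degenerate interval receives the empty partition,
    with \<open>m = 0\<close>.\<close>
  proof (cases "c = d")
    case True
    then show ?thesis
      by (intro exI[of _ 0] exI[of _ "\<lambda>_. c"]) (simp add: tagged_partition_def tag_fine_def)
  next
    case False
    with that show ?thesis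
      by (intro exI[of _ 1] exI[of _ "\<lambda>i. if i = 0 then c else d"] exI[of _ "\<lambda>_. x"])
        (auto simp: tagged_partition_def tag_fine_def)
  qed
  then show "\<exists>d>0. \<forall>a b. a \<le> x \<and> x \<le> b \<and> b - a < d \<longrightarrow>
      (\<exists>m t \<xi>. tagged_partition a b m t \<xi> \<and> tag_fine \<delta> m t \<xi>)"
    using pos[of x] x by (intro exI[of _ "\<delta> x"]) auto
qed

definition riemann_sum ::
    "(real \<Rightarrow> real) \<Rightarrow> (real \<Rightarrow> real) \<Rightarrow> nat \<Rightarrow> (nat \<Rightarrow> real) \<Rightarrow> (nat \<Rightarrow> real) \<Rightarrow> real" where
  "riemann_sum v u m t \<xi> = (\<Sum>i=1..m. v (\<xi> i) * (u (t i) - u (t (i - 1))))"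

section \<open>Linearity in the integrator, bounds and uniqueness\<close>

lemma has_KHS_integralI:
  assumes "\<And>\<epsilon>. \<epsilon> > 0 \<Longrightarrow> \<exists>\<delta>. (\<forall>s\<in>{a..b}. \<delta> s > 0) \<and>
    (\<forall>m t \<xi>. tagged_partition a b m t \<xi> \<longrightarrow> tag_fine \<delta> m t \<xi> \<longrightarrow> \<bar>riemann_sum v u m t \<xi> - I\<bar> < \<epsilon>)"
  shows "has_KHS_integral v u a b I"
  using assms unfolding has_KHS_integral_def tag_fine_def riemann_sum_def imp_conjL by blast

lemma has_KHS_integralD:
  assumes "has_KHS_integral v u a b I" "\<epsilon> > 0"
  obtains \<delta> where "\<And>s. s \<in> {a..b} \<Longrightarrow> \<delta> s > 0"
    "\<And>m t \<xi>. tagged_partition a b m t \<xi> \<Longrightarrow> tag_fine \<delta> m t \<xi> \<Longrightarrow> \<bar>riemann_sum v u m t \<xi> - I\<bar> < \<epsilon>"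
proof -
  have "\<exists>\<delta>. (\<forall>s\<in>{a..b}. \<delta> s > 0) \<and> (\<forall>m t \<xi>. tagged_partition a b m t \<xi> \<and> tag_fine \<delta> m t \<xi> \<longrightarrow>
      \<bar>riemann_sum v u m t \<xi> - I\<bar> < \<epsilon>)"
    using assms unfolding has_KHS_integral_def tag_fine_def riemann_sum_def by simp
  then show ?thesis using that by blast
qed

lemma has_KHS_integral_add:
  assumes "has_KHS_integral v u a b I" "has_KHS_integral v w a b J"
  shows "has_KHS_integral v (\<lambda>s. u s + w s) a b (I + J)"
proof (rule has_KHS_integralI)
  fix \<epsilon> :: real assume "\<epsilon> > 0"
  then have e: "\<epsilon> / 2 > 0" by simp
  obtain \<delta> where 1: "\<And>s. s \<in> {a..b} \<Longrightarrow> \<delta> s > 0"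
    "\<And>m t \<xi>. tagged_partition a b m t \<xi> \<Longrightarrow> tag_fine \<delta> m t \<xi> \<Longrightarrow> \<bar>riemann_sum v u m t \<xi> - I\<bar> < \<epsilon> / 2"
    by (rule has_KHS_integralD[OF assms(1) e]) blast
  obtain \<delta>' where 2: "\<And>s. s \<in> {a..b} \<Longrightarrow> \<delta>' s > 0"
    "\<And>m t \<xi>. tagged_partition a b m t \<xi> \<Longrightarrow> tag_fine \<delta>' m t \<xi> \<Longrightarrow> \<bar>riemann_sum v w m t \<xi> - J\<bar> < \<epsilon> / 2"
    by (rule has_KHS_integralD[OF assms(2) e]) blast
  have *: "riemann_sum v (\<lambda>s. u s + w s) m t \<xi> = riemann_sum v u m t \<xi> + riemann_sum v w m t \<xi>" for m t \<xi>
    unfolding riemann_sum_def sum.distrib[symmetric] by (rule sum.cong) (auto simp: algebra_simps)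
  show "\<exists>\<delta>. (\<forall>s\<in>{a..b}. \<delta> s > 0) \<and> (\<forall>m t \<xi>. tagged_partition a b m t \<xi> \<longrightarrow> tag_fine \<delta> m t \<xi> \<longrightarrow>
      \<bar>riemann_sum v (\<lambda>s. u s + w s) m t \<xi> - (I + J)\<bar> < \<epsilon>)"
  proof (intro exI conjI ballI allI impI)
    show "min (\<delta> s) (\<delta>' s) > 0" if "s \<in> {a..b}" for s using 1 2 that by simp
    fix m t \<xi> assume P: "tagged_partition a b m t \<xi>" "tag_fine (\<lambda>s. min (\<delta> s) (\<delta>' s)) m t \<xi>"
    with 1(2)[of m t \<xi>] 2(2)[of m t \<xi>] show "\<bar>riemann_sum v (\<lambda>s. u s + w s) m t \<xi> - (I + J)\<bar> < \<epsilon>"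
      unfolding tag_fine_min * by linarith
  qed
qed

lemma has_KHS_integral_cmult:
  assumes "has_KHS_integral v u a b I"
  shows "has_KHS_integral v (\<lambda>s. c * u s) a b (c * I)"
proof (rule has_KHS_integralI)
  fix \<epsilon> :: real assume "\<epsilon> > 0"
  \<comment> \<open>The added 1 keeps the denominator positive when \<open>c = 0\<close>.\<close>
  then have e: "\<epsilon> / (\<bar>c\<bar> + 1) > 0" by simp
  obtain \<delta> where 1: "\<And>s. s \<in> {a..b} \<Longrightarrow> \<delta> s > 0"
    "\<And>m t \<xi>. tagged_partition a b m t \<xi> \<Longrightarrow> tag_fine \<delta> m t \<xi> \<Longrightarrow> \<bar>riemann_sum v u m t \<xi> - I\<bar> < \<epsilon> / (\<bar>c\<bar> + 1)"
    by (rule has_KHS_integralD[OF assms(1) e]) blast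
  have *: "riemann_sum v (\<lambda>s. c * u s) m t \<xi> = c * riemann_sum v u m t \<xi>" for m t \<xi>
    unfolding riemann_sum_def sum_distrib_left by (rule sum.cong) (auto simp: algebra_simps)
  show "\<exists>\<delta>. (\<forall>s\<in>{a..b}. \<delta> s > 0) \<and> (\<forall>m t \<xi>. tagged_partition a b m t \<xi> \<longrightarrow> tag_fine \<delta> m t \<xi> \<longrightarrow>
      \<bar>riemann_sum v (\<lambda>s. c * u s) m t \<xi> - c * I\<bar> < \<epsilon>)"
  proof (intro exI[of _ \<delta>] conjI ballI allI impI)
    fix m t \<xi> assume P: "tagged_partition a b m t \<xi>" "tag_fine \<delta> m t \<xi>"
    have "\<bar>c\<bar> * \<bar>riemann_sum v u m t \<xi> - I\<bar> \<le> (\<bar>c\<bar> + 1) * \<bar>riemann_sum v u m t \<xi> - I\<bar>"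
      by (simp add: mult_right_mono)
    also have "\<dots> < \<epsilon>"
      using 1(2)[OF P] by (simp add: pos_less_divide_eq mult.commute)
    finally show "\<bar>riemann_sum v (\<lambda>s. c * u s) m t \<xi> - c * I\<bar> < \<epsilon>"
      unfolding * by (simp add: abs_mult flip: right_diff_distrib)
  qed (use 1 in auto)
qed

text \<open>By Cousin's lemma each gauge admits a fine partition, so \<open>I\<close> lies within
  every \<open>\<epsilon>\<close> of some Riemann sum.\<close>

lemma has_KHS_integral_bound:
  assumes "a \<le> b" "has_KHS_integral v u a b I"
    and le: "\<And>m t \<xi>. tagged_partition a b m t \<xi> \<Longrightarrow> \<bar>riemann_sum v u m t \<xi>\<bar> \<le> K"
  shows "\<bar>I\<bar> \<le> K"
proof (rule field_le_epsilon)
  fix \<epsilon> :: real assume "\<epsilon> > 0"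
  obtain \<delta> where 1: "\<And>s. s \<in> {a..b} \<Longrightarrow> \<delta> s > 0"
    "\<And>m t \<xi>. tagged_partition a b m t \<xi> \<Longrightarrow> tag_fine \<delta> m t \<xi> \<Longrightarrow> \<bar>riemann_sum v u m t \<xi> - I\<bar> < \<epsilon>"
    by (rule has_KHS_integralD[OF assms(2) \<open>\<epsilon> > 0\<close>]) blast
  obtain m t \<xi> where P: "tagged_partition a b m t \<xi>" "tag_fine \<delta> m t \<xi>"
    using tag_fine_partition_exists[OF \<open>a \<le> b\<close>, of \<delta>] 1(1) by blast
  show "\<bar>I\<bar> \<le> K + \<epsilon>"
    using 1(2)[OF P] le[OF P(1)] by linarith
qed

text \<open>The integrator \<open>u - u\<close> has integral \<open>I - J\<close>, while all its
  Riemann sums vanish.\<close>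

lemma has_KHS_integral_unique:
  assumes "a \<le> b" "has_KHS_integral v u a b I" "has_KHS_integral v u a b J"
  shows "I = J"
proof -
  have "has_KHS_integral v (\<lambda>s. u s + - 1 * u s) a b (I + - 1 * J)"
    by (intro has_KHS_integral_add has_KHS_integral_cmult assms)
  then have "\<bar>I + - 1 * J\<bar> \<le> 0"
    by (rule has_KHS_integral_bound[OF assms(1)]) (simp add: riemann_sum_def)
  then show ?thesis by simp
qed

lemma KHS_integral_eqI:
  assumes "a \<le> b" "has_KHS_integral v u a b I"
  shows "KHS_integral v u a b = I"
  unfolding KHS_integral_def using assms has_KHS_integral_unique by blast

lemma has_KHS_integral_KHS_integral:
  "KHS_integrable v u a b \<Longrightarrow> has_KHS_integral v u a b (KHS_integral v u a b)"
  unfolding KHS_integrable_def KHS_integral_def by (rule someI_ex)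

text \<open>Strictly increasing nodes leave only the empty partition. This later gives
  \<open>N 0 x = 0\<close>, which identifies the parameter \<open>c\<close> with
  \<open>Dx 0\<close>.\<close>

lemma KHS_integral_refl: "KHS_integral v u a a = 0"
proof (rule KHS_integral_eqI[OF order_refl has_KHS_integralI])
  fix \<epsilon> :: real assume "\<epsilon> > 0"
  have "m = 0" if P: "tagged_partition a a m t \<xi>" for m t \<xi>
  proof (rule ccontr)
    assume "m \<noteq> 0"
    then have "t (1 - 1) < t 1"
      using P unfolding tagged_partition_def by (meson atLeastAtMost_iff le_refl less_one not_less)
    then show False
      using tagged_partition_point[OF P, of 1] tagged_partition_point[OF P, of 0] \<open>m \<noteq> 0\<close> by simp
  qed
  then show "\<exists>\<delta>. (\<forall>s\<in>{a..a}. \<delta> s > 0) \<and> (\<forall>m t \<xi>. tagged_partition a a m t \<xi> \<longrightarrow> tag_fine \<delta> m t \<xi> \<longrightarrow>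
      \<bar>riemann_sum v u m t \<xi> - 0\<bar> < \<epsilon>)"
    using \<open>\<epsilon> > 0\<close> by (intro exI[of _ "\<lambda>_. 1"]) (auto simp: riemann_sum_def)
qed

text \<open>Tags lie in \<open>{a..b}\<close>, so only the values of the integrand there enter the
  sums. Hence \<open>G_int g u t x\<close> sees \<open>x\<close> on \<open>{0..t}\<close>
  only.\<close>

lemma has_KHS_integral_cong:
  assumes "\<And>s. s \<in> {a..b} \<Longrightarrow> v s = v' s"
  shows "has_KHS_integral v u a b I \<longleftrightarrow> has_KHS_integral v' u a b I"
proof -
  have "riemann_sum v u m t \<xi> = riemann_sum v' u m t \<xi>" if "tagged_partition a b m t \<xi>" for m t \<xi>
    unfolding riemann_sum_def by (rule sum.cong) (use tagged_partition_tag(2)[OF that] assms in auto)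
  then show ?thesis
    unfolding has_KHS_integral_def by (fold tag_fine_def riemann_sum_def) (simp cong: conj_cong imp_cong)
qed

lemma KHS_integral_cong:
  assumes "\<And>s. s \<in> {a..b} \<Longrightarrow> v s = v' s"
  shows "KHS_integral v u a b = KHS_integral v' u a b"
  unfolding KHS_integral_def using has_KHS_integral_cong[of a b v v' u, OF assms] by (intro arg_cong[of _ _ Eps] ext) auto

section \<open>Regulated functions\<close>

text \<open>The value at the discontinuity is a parameter of its own, because a regulated function
  has to be approximated at that point too.\<close>

definition jump :: "real \<Rightarrow> real \<Rightarrow> real \<Rightarrow> real \<Rightarrow> real \<Rightarrow> real" where
  "jump \<tau> p q r s = (if s < \<tau> then p else if s = \<tau> then q else r)"

text \<open>Generating step functions as sums of single jumps, instead of listing subdivision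
  points, reduces linear statements by induction to one jump.\<close>

inductive step_function :: "(real \<Rightarrow> real) \<Rightarrow> bool" where
  jump: "step_function (jump \<tau> p q r)"
| add: "step_function \<phi> \<Longrightarrow> step_function \<psi> \<Longrightarrow> step_function (\<lambda>s. \<phi> s + \<psi> s)"

text \<open>Truncating a jump at \<open>b\<close> leaves a jump or a sum of two, depending on the
  position of \<open>\<tau>\<close> relative to \<open>b\<close>. This is what allows step functions
  to be glued.\<close>

lemma step_function_cut:
  assumes "step_function \<phi>"
  shows "step_function (\<lambda>s. if s \<le> b then \<phi> s else 0)" "step_function (\<lambda>s. if s \<le> b then 0 else \<phi> s)"
  using assms
proof (induction)
  case (jump \<tau> p q r)
  consider "\<tau> < b" | "\<tau> = b" | "\<tau> > b" by linarith
  note cases = this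
  { case 1
    show ?case
    proof (cases rule: cases)
      case 1
      then have "(\<lambda>s. if s \<le> b then jump \<tau> p q r s else 0) = (\<lambda>s. jump \<tau> p q r s + jump b 0 0 (- r) s)"
        by (auto simp: jump_def)
      then show ?thesis by (simp add: step_function.intros)
    next
      case 2
      then have "(\<lambda>s. if s \<le> b then jump \<tau> p q r s else 0) = jump b p q 0"
        by (auto simp: jump_def)
      then show ?thesis by (simp add: step_function.intros)
    next
      case 3
      then have "(\<lambda>s. if s \<le> b then jump \<tau> p q r s else 0) = jump b p p 0"
        by (auto simp: jump_def)
      then show ?thesis by (simp add: step_function.intros)
    qed
  next
    case 2
    show ?case
    proof (cases rule: cases)
      case 1
      then have "(\<lambda>s. if s \<le> b then 0 else jump \<tau> p q r s) = jump b 0 0 r"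
        by (auto simp: jump_def)
      then show ?thesis by (simp add: step_function.intros)
    next
      case 2
      then have "(\<lambda>s. if s \<le> b then 0 else jump \<tau> p q r s) = jump b 0 0 r"
        by (auto simp: jump_def)
      then show ?thesis by (simp add: step_function.intros)
    next
      case 3
      then have "(\<lambda>s. if s \<le> b then 0 else jump \<tau> p q r s) = (\<lambda>s. jump \<tau> p q r s + jump b (- p) (- p) 0 s)"
        by (auto simp: jump_def)
      then show ?thesis by (simp add: step_function.intros)
    qed }
next
  case (add \<phi> \<psi>)
  { case 1
    have "(\<lambda>s. if s \<le> b then \<phi> s + \<psi> s else 0)
        = (\<lambda>s. (if s \<le> b then \<phi> s else 0) + (if s \<le> b then \<psi> s else 0))" by auto
    with add.IH show ?case by (simp only: step_function.add)
  next
    case 2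
    have "(\<lambda>s. if s \<le> b then 0 else \<phi> s + \<psi> s)
        = (\<lambda>s. (if s \<le> b then 0 else \<phi> s) + (if s \<le> b then 0 else \<psi> s))" by auto
    with add.IH show ?case by (simp only: step_function.add) }
qed

lemma step_function_piecewise:
  assumes "step_function \<phi>" "step_function \<psi>"
  shows "step_function (\<lambda>s. if s \<le> b then \<phi> s else \<psi> s)"
proof -
  have "(\<lambda>s. if s \<le> b then \<phi> s else \<psi> s)
      = (\<lambda>s. (if s \<le> b then \<phi> s else 0) + (if s \<le> b then 0 else \<psi> s))" by auto
  then show ?thesis using step_function.add[OF step_function_cut(1)[OF assms(1)] step_function_cut(2)[OF assms(2)]]
    by simp
qed

text \<open>Bisection again: approximations on adjacent intervals are glued, and near
  \<open>x\<close> the two one-sided limits together with the value \<open>u x\<close> form a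
  sufficiently close jump.\<close>

lemma regulated_on_uniform_step:
  assumes reg: "regulated_on a b u" and "a \<le> b" "\<epsilon> > 0"
  shows "\<exists>\<phi>. step_function \<phi> \<and> (\<forall>s\<in>{a..b}. \<bar>u s - \<phi> s\<bar> \<le> \<epsilon>)"
proof -
  \<comment> \<open>The local hypothesis of \<open>Bolzano\<close> also concerns intervals
    protruding from \<open>{a..b}\<close>; the intersection makes \<open>P\<close> ignore the
    outside.\<close>
  define P where "P c d \<longleftrightarrow> (\<exists>\<phi>. step_function \<phi> \<and> (\<forall>s\<in>{c..d} \<inter> {a..b}. \<bar>u s - \<phi> s\<bar> \<le> \<epsilon>))" for c d
  have "P a b"
    using assms(2)
  proof (rule Bolzano)
    fix c d e assume "P c d" "P d e" "c \<le> d" "d \<le> e"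
    then obtain \<phi> \<psi> where s: "step_function \<phi>" "step_function \<psi>"
      and \<phi>: "\<forall>s\<in>{c..d} \<inter> {a..b}. \<bar>u s - \<phi> s\<bar> \<le> \<epsilon>" and \<psi>: "\<forall>s\<in>{d..e} \<inter> {a..b}. \<bar>u s - \<psi> s\<bar> \<le> \<epsilon>"
      unfolding P_def by blast
    show "P c e"
      unfolding P_def
      by (rule exI[of _ "\<lambda>s. if s \<le> d then \<phi> s else \<psi> s"]) (use \<phi> \<psi> step_function_piecewise[OF s] in auto)
  next
    fix x assume x: "a \<le> x" "x \<le> b"
    obtain l d1 where l: "0 < d1" "\<And>s. a \<le> s \<Longrightarrow> s < x \<Longrightarrow> x - s < d1 \<Longrightarrow> \<bar>u s - l\<bar> \<le> \<epsilon>"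
    proof (cases "x = a")
      \<comment> \<open>At the left end the condition on \<open>s\<close> is vacuous, so any
        \<open>l\<close> serves.\<close>
      case True then show thesis by (intro that[of 1]) auto
    next
      case False
      then have "x \<in> {a<..b}" using x by auto
      then obtain l where "(u \<longlongrightarrow> l) (at_left x)" using reg unfolding regulated_on_def by blast
      then have "\<forall>\<^sub>F s in at_left x. dist (u s) l < \<epsilon>" using \<open>\<epsilon> > 0\<close> by (rule tendstoD)
      then obtain y where "y < x" "\<And>s. y < s \<Longrightarrow> s < x \<Longrightarrow> dist (u s) l < \<epsilon>"
        unfolding eventually_at_left_field by blast
      then show thesis by (intro that[of "x - y" l]) (auto simp: dist_real_def less_imp_le)
    qed
    obtain r d2 where r: "0 < d2" "\<And>s. s \<le> b \<Longrightarrow> x < s \<Longrightarrow> s - x < d2 \<Longrightarrow> \<bar>u s - r\<bar> \<le> \<epsilon>"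
    proof (cases "x = b")
      case True then show thesis by (intro that[of 1]) auto
    next
      case False
      then have "x \<in> {a..<b}" using x by auto
      then obtain l where "(u \<longlongrightarrow> l) (at_right x)" using reg unfolding regulated_on_def by blast
      then have "\<forall>\<^sub>F s in at_right x. dist (u s) l < \<epsilon>" using \<open>\<epsilon> > 0\<close> by (rule tendstoD)
      then obtain y where "y > x" "\<And>s. x < s \<Longrightarrow> s < y \<Longrightarrow> dist (u s) l < \<epsilon>"
        unfolding eventually_at_right_field by blast
      then show thesis by (intro that[of "y - x" l]) (auto simp: dist_real_def less_imp_le)
    qed
    have "P c d" if "c \<le> x" "x \<le> d" "d - c < min d1 d2" for c d
      unfolding P_def
      by (rule exI[of _ "jump x l (u x) r"])
        (use l r that \<open>\<epsilon> > 0\<close> in \<open>auto simp: jump_def step_function.intros\<close>)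
    then show "\<exists>d>0. \<forall>a b. a \<le> x \<and> x \<le> b \<and> b - a < d \<longrightarrow> P a b"
      using l(1) r(1) by (intro exI[of _ "min d1 d2"]) auto
  qed
  then show ?thesis by (auto simp: P_def)
qed

lemma step_function_bounded: "step_function \<phi> \<Longrightarrow> \<exists>W. \<forall>s. \<bar>\<phi> s\<bar> \<le> W"
proof (induction rule: step_function.induct)
  case (jump \<tau> p q r)
  show ?case by (rule exI[of _ "\<bar>p\<bar> + \<bar>q\<bar> + \<bar>r\<bar>"]) (auto simp: jump_def)
next
  case (add \<phi> \<psi>)
  then obtain V W where "\<forall>s. \<bar>\<phi> s\<bar> \<le> V" "\<forall>s. \<bar>\<psi> s\<bar> \<le> W" by blast
  then have "\<bar>\<phi> s + \<psi> s\<bar> \<le> V + W" for s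
    using abs_triangle_ineq[of "\<phi> s" "\<psi> s"] by (meson add_mono order_trans)
  then show ?case by blast
qed

lemma regulated_on_bounded:
  assumes "regulated_on a b u" "a \<le> b"
  shows "\<exists>W. \<forall>s\<in>{a..b}. \<bar>u s\<bar> \<le> W"
proof -
  obtain \<phi> where \<phi>: "step_function \<phi>" "\<forall>s\<in>{a..b}. \<bar>u s - \<phi> s\<bar> \<le> 1"
    using regulated_on_uniform_step[OF assms, of 1] by auto
  obtain W where "\<And>s. \<bar>\<phi> s\<bar> \<le> W" using step_function_bounded[OF \<phi>(1)] by blast
  with \<phi>(2) have "\<bar>u s\<bar> \<le> W + 1" if "s \<in> {a..b}" for s
    using that by (smt (verit))
  then show ?thesis by blast
qed

lemma jump_integrable: "jump \<tau> p q r integrable_on {a..b}"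
proof -
  \<comment> \<open>The closed half-line comes first because it meets \<open>{a..b}\<close> in a
    closed interval; altering the single point \<open>\<tau>\<close> then gives the open
    one.\<close>
  have 1: "(\<lambda>s. if s \<in> {..<\<tau>} then p - r else 0) integrable_on {a..b}"
  proof (rule integrable_spike_finite[of "{\<tau>}"])
    show "(\<lambda>s. if s \<in> {..\<tau>} then p - r else 0) integrable_on {a..b}"
    proof -
      have "{..\<tau>} \<inter> {a..b} = {a..min \<tau> b}" by auto
      then have "(\<lambda>s. p - r) integrable_on {..\<tau>} \<inter> {a..b}" by (simp add: integrable_const_ivl)
      then show ?thesis by (simp only: integrable_restrict_Int)
    qed
  qed auto
  have "(\<lambda>s. (if s \<in> {..<\<tau>} then p - r else 0) + r) integrable_on {a..b}"
    by (intro integrable_add 1 integrable_const_ivl)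
  then show ?thesis
    by (rule integrable_spike_finite[of "{\<tau>}", rotated 2]) (auto simp: jump_def)
qed

lemma step_function_integrable: "step_function \<phi> \<Longrightarrow> \<phi> integrable_on {a..b}"
  by (induction rule: step_function.induct) (auto intro: jump_integrable integrable_add)

lemma regulated_on_integrable:
  assumes "regulated_on a b u" "a \<le> b"
  shows "u integrable_on {a..b}"
proof -
  have "u integrable_on cbox a b"
    by (rule integrable_uniform_limit)
      (use regulated_on_uniform_step[OF assms] step_function_integrable in \<open>fastforce\<close>)
  then show ?thesis by simp
qed

section \<open>Closure properties of regulated functions\<close>

lemma regulated_on_add:
  assumes "regulated_on a b u" "regulated_on a b w"
  shows "regulated_on a b (\<lambda>s. u s + w s)"
  unfolding regulated_on_def
proof (intro conjI ballI)
  fix t assume "t \<in> {a..<b}"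
  then obtain l m where "(u \<longlongrightarrow> l) (at_right t)" "(w \<longlongrightarrow> m) (at_right t)"
    using assms unfolding regulated_on_def by blast
  from tendsto_add[OF this] show "\<exists>l. ((\<lambda>s. u s + w s) \<longlongrightarrow> l) (at_right t)" ..
next
  fix t assume "t \<in> {a<..b}"
  then obtain l m where "(u \<longlongrightarrow> l) (at_left t)" "(w \<longlongrightarrow> m) (at_left t)"
    using assms unfolding regulated_on_def by blast
  from tendsto_add[OF this] show "\<exists>l. ((\<lambda>s. u s + w s) \<longlongrightarrow> l) (at_left t)" ..
qed

lemma regulated_on_continuous:
  assumes "continuous_on {a..b} x"
  shows "regulated_on a b x"
  unfolding regulated_on_def
proof (intro conjI ballI)
  fix t assume t: "t \<in> {a..<b}"
  have "(x \<longlongrightarrow> x t) (at t within {a..b})" using assms t by (auto simp: continuous_on)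
  then have "(x \<longlongrightarrow> x t) (at t within {t..b})" by (rule tendsto_within_subset) (use t in auto)
  then show "\<exists>l. (x \<longlongrightarrow> l) (at_right t)" using t by (auto simp: at_within_Icc_at_right)
next
  fix t assume t: "t \<in> {a<..b}"
  have "(x \<longlongrightarrow> x t) (at t within {a..b})" using assms t by (auto simp: continuous_on)
  then have "(x \<longlongrightarrow> x t) (at t within {a..t})" by (rule tendsto_within_subset) (use t in auto)
  then show "\<exists>l. (x \<longlongrightarrow> l) (at_left t)" using t by (auto simp: at_within_Icc_at_left)
qed

text \<open>The approximants make the image of \<open>F\<close> under \<open>u\<close> a Cauchy
  filter, so completeness supplies the limit without a candidate for it.\<close>

lemma tendsto_uniform_approx:
  fixes u :: "real \<Rightarrow> real"
  assumes "F \<noteq> bot" and approx: "\<And>e. e > 0 \<Longrightarrow> \<exists>w l. (w \<longlongrightarrow> l) F \<and> (\<forall>\<^sub>F s in F. \<bar>u s - w s\<bar> \<le> e)"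
  shows "\<exists>l. (u \<longlongrightarrow> l) F"
proof -
  have "cauchy_filter (filtermap u F)"
    unfolding cauchy_filter_metric_filtermap
  proof (intro allI impI)
    fix e :: real assume "e > 0"
    then have e: "e / 4 > 0" by simp
    obtain w l where w: "(w \<longlongrightarrow> l) F" "\<forall>\<^sub>F s in F. \<bar>u s - w s\<bar> \<le> e / 4"
      using approx[OF e] by blast
    have "\<forall>\<^sub>F s in F. \<bar>u s - l\<bar> < e / 2"
      using tendstoD[OF w(1) e] w(2) by eventually_elim (unfold dist_real_def, linarith)
    moreover have "dist (u x) (u y) < e" if "\<bar>u x - l\<bar> < e / 2 \<and> \<bar>u y - l\<bar> < e / 2" for x y
      using that unfolding dist_real_def by linarith
    ultimately show "\<exists>P. eventually P F \<and> (\<forall>x y. P x \<and> P y \<longrightarrow> dist (u x) (u y) < e)"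
      by blast
  qed
  then have "\<exists>l. filtermap u F \<le> nhds l"
    by (rule cauchy_filter_complete_converges[OF _ complete_UNIV]) (use assms(1) in \<open>auto simp: filtermap_bot_iff\<close>)
  then show ?thesis by (simp add: filterlim_def)
qed

lemma regulated_on_uniform_approx:
  assumes approx: "\<And>e. e > 0 \<Longrightarrow> \<exists>w. regulated_on a b w \<and> (\<forall>s\<in>{a..b}. \<bar>u s - w s\<bar> \<le> e)"
  shows "regulated_on a b u"
  unfolding regulated_on_def
proof (intro conjI ballI)
  fix t assume t: "t \<in> {a..<b}"
  then have *: "\<forall>\<^sub>F s in at_right t. s \<in> {a..b}"
    unfolding eventually_at_right_field by (intro exI[of _ b]) auto
  show "\<exists>l. (u \<longlongrightarrow> l) (at_right t)"
  proof (rule tendsto_uniform_approx)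
    fix e :: real assume "e > 0"
    then obtain w where w: "regulated_on a b w" "\<forall>s\<in>{a..b}. \<bar>u s - w s\<bar> \<le> e"
      using approx by blast
    obtain l where "(w \<longlongrightarrow> l) (at_right t)" using w(1) t unfolding regulated_on_def by blast
    moreover have "\<forall>\<^sub>F s in at_right t. \<bar>u s - w s\<bar> \<le> e" using * by eventually_elim (use w(2) in blast)
    ultimately show "\<exists>w l. (w \<longlongrightarrow> l) (at_right t) \<and> (\<forall>\<^sub>F s in at_right t. \<bar>u s - w s\<bar> \<le> e)" by blast
  qed simp
next
  fix t assume t: "t \<in> {a<..b}"
  then have *: "\<forall>\<^sub>F s in at_left t. s \<in> {a..b}"
    unfolding eventually_at_left_field by (intro exI[of _ a]) auto
  show "\<exists>l. (u \<longlongrightarrow> l) (at_left t)"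
  proof (rule tendsto_uniform_approx)
    fix e :: real assume "e > 0"
    then obtain w where w: "regulated_on a b w" "\<forall>s\<in>{a..b}. \<bar>u s - w s\<bar> \<le> e"
      using approx by blast
    obtain l where "(w \<longlongrightarrow> l) (at_left t)" using w(1) t unfolding regulated_on_def by blast
    moreover have "\<forall>\<^sub>F s in at_left t. \<bar>u s - w s\<bar> \<le> e" using * by eventually_elim (use w(2) in blast)
    ultimately show "\<exists>w l. (w \<longlongrightarrow> l) (at_left t) \<and> (\<forall>\<^sub>F s in at_left t. \<bar>u s - w s\<bar> \<le> e)" by blast
  qed simp
qed

section \<open>Integrating functions of bounded variation against regulated functions\<close>

lemma has_KHS_integral_jump: "has_KHS_integral v (jump \<tau> p q r) a t (v \<tau> * (jump \<tau> p q r t - jump \<tau> p q r a))"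
proof (rule has_KHS_integralI)
  fix \<epsilon> :: real assume "\<epsilon> > 0"
  \<comment> \<open>This gauge forces a subinterval that contains \<open>\<tau>\<close> to be tagged by \<open>\<tau>\<close>.\<close>
  let ?\<delta> = "\<lambda>s. if s = \<tau> then 1 else \<bar>s - \<tau>\<bar>" and ?\<phi> = "jump \<tau> p q r"
  have "riemann_sum v ?\<phi> m \<theta> \<xi> = v \<tau> * (?\<phi> t - ?\<phi> a)"
    if P: "tagged_partition a t m \<theta> \<xi>" "tag_fine ?\<delta> m \<theta> \<xi>" for m \<theta> \<xi>
  proof -
    \<comment> \<open>Either the tag is \<open>\<tau>\<close> or the increment of the jump is 0, so
      \<open>v\<close> may be frozen at \<open>\<tau>\<close> in every term; the remaining sum
      telescopes.\<close>
    have "v (\<xi> i) * (?\<phi> (\<theta> i) - ?\<phi> (\<theta> (i - 1))) = v \<tau> * (?\<phi> (\<theta> i) - ?\<phi> (\<theta> (i - 1)))" if i: "i \<in> {1..m}" for i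
    proof (cases "\<tau> \<in> {\<theta> (i - 1)..\<theta> i}")
      case True
      then have "\<tau> \<in> {\<xi> i - ?\<delta> (\<xi> i)<..<\<xi> i + ?\<delta> (\<xi> i)}"
        using P(2) i unfolding tag_fine_def by blast
      then have "\<xi> i = \<tau>" by (auto split: if_splits)
      then show ?thesis by simp
    next
      case False
      have "\<theta> (i - 1) < \<theta> i" using P(1) i unfolding tagged_partition_def by blast
      with False have "?\<phi> (\<theta> i) = ?\<phi> (\<theta> (i - 1))" by (auto simp: jump_def)
      then show ?thesis by simp
    qed
    then have "riemann_sum v ?\<phi> m \<theta> \<xi> = v \<tau> * (\<Sum>i=1..m. ?\<phi> (\<theta> i) - ?\<phi> (\<theta> (i - 1)))"
      unfolding riemann_sum_def sum_distrib_left by (intro sum.cong) auto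
    also have "(\<Sum>i=1..m. ?\<phi> (\<theta> i) - ?\<phi> (\<theta> (i - 1))) = ?\<phi> (\<theta> m) - ?\<phi> (\<theta> 0)"
      by (induction m) auto
    finally show ?thesis using P(1) by (simp add: tagged_partition_def)
  qed
  then show "\<exists>\<delta>. (\<forall>s\<in>{a..t}. \<delta> s > 0) \<and> (\<forall>m \<theta> \<xi>. tagged_partition a t m \<theta> \<xi> \<longrightarrow> tag_fine \<delta> m \<theta> \<xi> \<longrightarrow>
      \<bar>riemann_sum v ?\<phi> m \<theta> \<xi> - v \<tau> * (?\<phi> t - ?\<phi> a)\<bar> < \<epsilon>)"
    using \<open>\<epsilon> > 0\<close> by (intro exI[of _ ?\<delta>]) auto
qed

lemma regulated_on_jump: "regulated_on a b (jump \<tau> p q r)"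
proof -
  have R: "\<exists>l. (jump \<tau> p q r \<longlongrightarrow> l) (at_right t)" for t
  proof (cases "t < \<tau>")
    case True
    have "\<forall>\<^sub>F s in at_right t. p = jump \<tau> p q r s"
      unfolding eventually_at_right_field using True by (intro exI[of _ \<tau>]) (auto simp: jump_def)
    then show ?thesis using tendsto_eventually by (fastforce simp: eq_commute)
  next
    case False
    have "\<forall>\<^sub>F s in at_right t. r = jump \<tau> p q r s"
      unfolding eventually_at_right_field using False by (intro exI[of _ "t + 1"]) (auto simp: jump_def)
    then show ?thesis using tendsto_eventually by (fastforce simp: eq_commute)
  qed
  have L: "\<exists>l. (jump \<tau> p q r \<longlongrightarrow> l) (at_left t)" for t
  proof (cases "t > \<tau>")
    case True
    have "\<forall>\<^sub>F s in at_left t. r = jump \<tau> p q r s"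
      unfolding eventually_at_left_field using True by (intro exI[of _ \<tau>]) (auto simp: jump_def)
    then show ?thesis using tendsto_eventually by (fastforce simp: eq_commute)
  next
    case False
    have "\<forall>\<^sub>F s in at_left t. p = jump \<tau> p q r s"
      unfolding eventually_at_left_field using False by (intro exI[of _ "t - 1"]) (auto simp: jump_def)
    then show ?thesis using tendsto_eventually by (fastforce simp: eq_commute)
  qed
  show ?thesis
    unfolding regulated_on_def using R L by blast
qed

lemma regulated_on_affine:
  assumes "regulated_on a b u"
  shows "regulated_on a b (\<lambda>t. c * (u t - d))"
  unfolding regulated_on_def
proof (intro conjI ballI)
  fix t assume "t \<in> {a..<b}"
  then obtain l where "(u \<longlongrightarrow> l) (at_right t)" using assms unfolding regulated_on_def by blast
  then have "((\<lambda>t. c * (u t - d)) \<longlongrightarrow> c * (l - d)) (at_right t)" by (intro tendsto_intros)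
  then show "\<exists>l. ((\<lambda>t. c * (u t - d)) \<longlongrightarrow> l) (at_right t)" ..
next
  fix t assume "t \<in> {a<..b}"
  then obtain l where "(u \<longlongrightarrow> l) (at_left t)" using assms unfolding regulated_on_def by blast
  then have "((\<lambda>t. c * (u t - d)) \<longlongrightarrow> c * (l - d)) (at_left t)" by (intro tendsto_intros)
  then show "\<exists>l. ((\<lambda>t. c * (u t - d)) \<longlongrightarrow> l) (at_left t)" ..
qed

text \<open>The integral against a step function is a finite combination of values of
  \<open>v\<close> with coefficients regulated in \<open>t\<close>. So one operator \<open>J\<close>
  covers arbitrary \<open>v\<close> and respects pointwise limits.\<close>

lemma step_function_KHS_integral:
  assumes "step_function \<phi>"
  shows "\<exists>J. (\<forall>v. \<forall>t\<in>{a..b}. has_KHS_integral v \<phi> a t (J v t)) \<and> (\<forall>v. regulated_on a b (J v)) \<and>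
    (\<forall>V v t. t \<in> {a..b} \<longrightarrow> (\<forall>s\<in>{a..b}. (\<lambda>n::nat. V n s) \<longlonglongrightarrow> v s) \<longrightarrow> (\<lambda>n. J (V n) t) \<longlonglongrightarrow> J v t)"
  using assms
proof (induction rule: step_function.induct)
  case (jump \<tau> p q r)
  let ?J = "\<lambda>v t. v \<tau> * (jump \<tau> p q r t - jump \<tau> p q r a)"
  have "(\<lambda>n::nat. ?J (V n) t) \<longlonglongrightarrow> ?J v t"
    if "t \<in> {a..b}" "\<forall>s\<in>{a..b}. (\<lambda>n. V n s) \<longlonglongrightarrow> v s" for V v t
  proof (cases "\<tau> \<in> {a..b}")
    case True
    with that show ?thesis by (intro tendsto_intros) auto
  next
    case False
    \<comment> \<open>Convergence of \<open>V n\<close> is known on \<open>{a..b}\<close> only; for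
      \<open>\<tau>\<close> outside, the coefficient of \<open>v \<tau>\<close> is 0.\<close>
    with that(1) have "jump \<tau> p q r t = jump \<tau> p q r a" by (auto simp: jump_def)
    then show ?thesis by simp
  qed
  then show ?case 
    by (intro exI[of _ ?J] conjI allI ballI impI has_KHS_integral_jump regulated_on_affine regulated_on_jump)
next
  case (add \<phi> \<psi>)
  from add.IH(1) obtain J1 where J1:
    "\<forall>v. \<forall>t\<in>{a..b}. has_KHS_integral v \<phi> a t (J1 v t)" "\<forall>v. regulated_on a b (J1 v)"
    "\<forall>V v t. t \<in> {a..b} \<longrightarrow> (\<forall>s\<in>{a..b}. (\<lambda>n::nat. V n s) \<longlonglongrightarrow> v s) \<longrightarrow> (\<lambda>n. J1 (V n) t) \<longlonglongrightarrow> J1 v t"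
    by (elim exE conjE)
  from add.IH(2) obtain J2 where J2:
    "\<forall>v. \<forall>t\<in>{a..b}. has_KHS_integral v \<psi> a t (J2 v t)" "\<forall>v. regulated_on a b (J2 v)"
    "\<forall>V v t. t \<in> {a..b} \<longrightarrow> (\<forall>s\<in>{a..b}. (\<lambda>n::nat. V n s) \<longlonglongrightarrow> v s) \<longrightarrow> (\<lambda>n. J2 (V n) t) \<longlonglongrightarrow> J2 v t"
    by (elim exE conjE)
  show ?case
    by (intro exI[of _ "\<lambda>v t. J1 v t + J2 v t"] conjI allI ballI impI has_KHS_integral_add regulated_on_add
        tendsto_add J1[rule_format] J2[rule_format]) blast+
qed

text \<open>\<open>riemann_sum_bound\<close> for the integrator \<open>u - w\<close> on
  \<open>{a..t}\<close>, with the variation taken on the larger \<open>{a..b}\<close>.\<close>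

lemma KHS_integral_diff_bound:
  assumes t: "t \<in> {a..b}" and M: "total_variation a b v \<le> ennreal M" "0 \<le> M" "v a = 0"
    and I: "has_KHS_integral v u a t I" "has_KHS_integral v w a t J"
    and W: "\<And>s. s \<in> {a..b} \<Longrightarrow> \<bar>u s - w s\<bar> \<le> W"
  shows "\<bar>I - J\<bar> \<le> 3 * M * \<bar>W\<bar>"
proof -
  have "has_KHS_integral v (\<lambda>s. u s + - 1 * w s) a t (I + - 1 * J)"
    by (intro has_KHS_integral_add has_KHS_integral_cmult I)
  then have "\<bar>I + - 1 * J\<bar> \<le> 3 * M * \<bar>W\<bar>"
  proof (rule has_KHS_integral_bound[rotated])
    fix m \<theta> \<xi> assume P: "tagged_partition a t m \<theta> \<xi>"
    show "\<bar>riemann_sum v (\<lambda>s. u s + - 1 * w s) m \<theta> \<xi>\<bar> \<le> 3 * M * \<bar>W\<bar>"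
      unfolding riemann_sum_def by (rule riemann_sum_bound[OF P _ M]) (use t W in auto)
  qed (use t in auto)
  then show ?thesis by simp
qed

text \<open>Comparison with the integrator \<open>0 * u\<close>, whose integral is 0.\<close>

lemma KHS_integral_bound:
  assumes t: "t \<in> {a..b}" and M: "total_variation a b v \<le> ennreal M" "0 \<le> M" "v a = 0"
    and I: "has_KHS_integral v u a t I" and W: "\<And>s. s \<in> {a..b} \<Longrightarrow> \<bar>u s\<bar> \<le> W"
  shows "\<bar>I\<bar> \<le> 3 * M * \<bar>W\<bar>"
  using KHS_integral_diff_bound[OF t M I has_KHS_integral_cmult[OF I, of 0], of W] W by simp

text \<open>The integrals against step functions tending uniformly to \<open>u\<close> form a Cauchy
  sequence. A gauge for one close approximant also works for \<open>u\<close>, since the Riemann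
  sums against the two differ by an amount bounded uniformly over partitions.\<close>

lemma KHS_integrable_regulated:
  assumes u: "regulated_on a b u" and t: "t \<in> {a..b}"
    and M: "total_variation a b v \<le> ennreal M" "0 \<le> M" "v a = 0"
  shows "KHS_integrable v u a t"
proof -
  have ab: "a \<le> b" using t by simp
  have "\<exists>\<phi>. step_function \<phi> \<and> (\<forall>s\<in>{a..b}. \<bar>u s - \<phi> s\<bar> \<le> 1 / real (Suc n))" for n
    by (rule regulated_on_uniform_step[OF u ab]) simp
  then obtain \<phi> where \<phi>: "\<And>n. step_function (\<phi> n)" "\<And>n s. s \<in> {a..b} \<Longrightarrow> \<bar>u s - \<phi> n s\<bar> \<le> 1 / real (Suc n)"
    by metis
  have "\<exists>I. has_KHS_integral v (\<phi> n) a t I" for n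
    using step_function_KHS_integral[OF \<phi>(1)[of n], of a b] t by blast
  then obtain I where I: "\<And>n. has_KHS_integral v (\<phi> n) a t (I n)" by metis
  have inv: "(\<lambda>n. K * (1 / real (Suc n))) \<longlonglongrightarrow> 0" for K :: real
    using tendsto_mult[OF tendsto_const[of K] LIMSEQ_inverse_real_of_nat] by (simp add: inverse_eq_divide)
  have small: "\<exists>N. \<forall>n\<ge>N. K * (1 / real (Suc n)) < e" if "e > 0" for K e :: real
    using order_tendstoD(2)[OF inv[of K] that] unfolding eventually_sequentially .
  have "Cauchy I"
    unfolding Cauchy_def
  proof (intro allI impI)
    fix e :: real assume "e > 0"
    \<comment> \<open>Two approximants beyond \<open>N\<close> differ by at most
      \<open>2 / Suc N\<close>; with the factor 3 of the integral bound this gives 6.\<close>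
    then obtain N where N: "\<And>n. n \<ge> N \<Longrightarrow> (6 * M) * (1 / real (Suc n)) < e" using small by blast
    have "dist (I m) (I n) < e" if "m \<ge> N" "n \<ge> N" for m n
    proof -
      have "\<bar>\<phi> m s - \<phi> n s\<bar> \<le> 2 * (1 / real (Suc N))" if "s \<in> {a..b}" for s
      proof -
        have "1 / real (Suc m) \<le> 1 / real (Suc N)" "1 / real (Suc n) \<le> 1 / real (Suc N)"
          using \<open>m \<ge> N\<close> \<open>n \<ge> N\<close> by (auto simp: field_simps)
        with \<phi>(2)[OF that, of m] \<phi>(2)[OF that, of n] show ?thesis by linarith
      qed
      then have "\<bar>I m - I n\<bar> \<le> 3 * M * \<bar>2 * (1 / real (Suc N))\<bar>"
        by (rule KHS_integral_diff_bound[OF t M I I])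
      also have "\<dots> = (6 * M) * (1 / real (Suc N))" by simp
      also have "\<dots> < e" using N[of N] by simp
      finally show ?thesis by (simp add: dist_real_def)
    qed
    then show "\<exists>N. \<forall>m\<ge>N. \<forall>n\<ge>N. dist (I m) (I n) < e" by blast
  qed
  then obtain L where L: "I \<longlonglongrightarrow> L" using Cauchy_convergent convergentD by blast
  have "has_KHS_integral v u a t L"
  proof (rule has_KHS_integralI)
    fix e :: real assume "e > 0"
    then have e: "e / 3 > 0" by simp
    obtain N1 where N1: "\<And>n. n \<ge> N1 \<Longrightarrow> (3 * M) * (1 / real (Suc n)) < e / 3" using small[OF e] by blast
    obtain N2 where N2: "\<And>n. n \<ge> N2 \<Longrightarrow> \<bar>I n - L\<bar> < e / 3"
      using L[unfolded LIMSEQ_iff, rule_format, OF e] unfolding real_norm_def by blast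
    \<comment> \<open>The index is fixed before the gauge, so a single step function controls all
      fine sums.\<close>
    define n where "n = max N1 N2"
    have n_ge: "n \<ge> N2" by (simp add: n_def)
    obtain \<delta> where \<delta>: "\<And>s. s \<in> {a..t} \<Longrightarrow> \<delta> s > 0"
      "\<And>m \<theta> \<xi>. tagged_partition a t m \<theta> \<xi> \<Longrightarrow> tag_fine \<delta> m \<theta> \<xi> \<Longrightarrow> \<bar>riemann_sum v (\<phi> n) m \<theta> \<xi> - I n\<bar> < e / 3"
      by (rule has_KHS_integralD[OF I[of n] e]) blast
    have "\<bar>riemann_sum v u m \<theta> \<xi> - L\<bar> < e" if P: "tagged_partition a t m \<theta> \<xi>" "tag_fine \<delta> m \<theta> \<xi>" for m \<theta> \<xi>
    proof -
      have "riemann_sum v u m \<theta> \<xi> - riemann_sum v (\<phi> n) m \<theta> \<xi> = riemann_sum v (\<lambda>s. u s - \<phi> n s) m \<theta> \<xi>"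
        unfolding riemann_sum_def sum_subtractf[symmetric] by (rule sum.cong) (auto simp: algebra_simps)
      also have "\<bar>\<dots>\<bar> \<le> 3 * M * \<bar>1 / real (Suc n)\<bar>"
        unfolding riemann_sum_def by (rule riemann_sum_bound[OF P(1) _ M]) (use t \<phi>(2) in auto)
      also have "\<dots> < e / 3" using N1[of n] by (simp add: n_def)
      finally show ?thesis using \<delta>(2)[OF P] N2[OF n_ge] by linarith
    qed
    then show "\<exists>\<delta>. (\<forall>s\<in>{a..t}. \<delta> s > 0) \<and> (\<forall>m \<theta> \<xi>. tagged_partition a t m \<theta> \<xi> \<longrightarrow> tag_fine \<delta> m \<theta> \<xi> \<longrightarrow>
      \<bar>riemann_sum v u m \<theta> \<xi> - L\<bar> < e)" using \<delta>(1) by blast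
  qed
  then show ?thesis unfolding KHS_integrable_def by blast
qed

text \<open>The error depends on \<open>v\<close> through \<open>M\<close> alone, so one
  \<open>J\<close> approximates the integral for all admissible \<open>v\<close> and all
  \<open>t\<close> at once. This uniformity transfers regularity in \<open>t\<close> and pointwise
  limits in \<open>v\<close> from \<open>J\<close> to the integral.\<close>

lemma KHS_integral_step_approx:
  assumes u: "regulated_on a b u" and ab: "a \<le> b" and "0 \<le> M" "e > 0"
  obtains J where "\<And>v t. t \<in> {a..b} \<Longrightarrow> total_variation a b v \<le> ennreal M \<Longrightarrow> v a = 0 \<Longrightarrow>
      \<bar>KHS_integral v u a t - J v t\<bar> \<le> e"
    and "\<And>v. regulated_on a b (J v)"
    and "\<And>V v t. t \<in> {a..b} \<Longrightarrow> (\<forall>s\<in>{a..b}. (\<lambda>n::nat. V n s) \<longlonglongrightarrow> v s) \<Longrightarrow> (\<lambda>n. J (V n) t) \<longlonglongrightarrow> J v t"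
proof -
  \<comment> \<open>Chosen so that \<open>3 * M * d \<le> e\<close>, with a positive denominator
    even for \<open>M = 0\<close>.\<close>
  define d where "d = e / (3 * M + 1)"
  have d: "d > 0" "3 * M * d \<le> e"
    using assms(3,4) by (auto simp: d_def field_simps)
  obtain \<phi> where \<phi>: "step_function \<phi>" "\<And>s. s \<in> {a..b} \<Longrightarrow> \<bar>u s - \<phi> s\<bar> \<le> d"
    using regulated_on_uniform_step[OF u ab d(1)] by blast
  obtain J where J: "\<forall>v. \<forall>t\<in>{a..b}. has_KHS_integral v \<phi> a t (J v t)" "\<forall>v. regulated_on a b (J v)"
    "\<forall>V v t. t \<in> {a..b} \<longrightarrow> (\<forall>s\<in>{a..b}. (\<lambda>n::nat. V n s) \<longlonglongrightarrow> v s) \<longrightarrow> (\<lambda>n. J (V n) t) \<longlonglongrightarrow> J v t"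
    using step_function_KHS_integral[OF \<phi>(1), of a b] by (elim exE conjE)
  have "\<bar>KHS_integral v u a t - J v t\<bar> \<le> e"
    if t: "t \<in> {a..b}" and v: "total_variation a b v \<le> ennreal M" "v a = 0" for v t
  proof -
    have "\<bar>KHS_integral v u a t - J v t\<bar> \<le> 3 * M * \<bar>d\<bar>"
      by (rule KHS_integral_diff_bound[OF t v(1) assms(3) v(2)
            has_KHS_integral_KHS_integral[OF KHS_integrable_regulated[OF u t v(1) assms(3) v(2)]] J(1)[rule_format, OF t] \<phi>(2)])
    then show ?thesis using d by simp
  qed
  then show ?thesis by (rule that) (use J in blast)+
qed

lemma regulated_on_KHS_integral:
  assumes u: "regulated_on a b u" and ab: "a \<le> b"
    and M: "total_variation a b v \<le> ennreal M" "0 \<le> M" "v a = 0"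
  shows "regulated_on a b (KHS_integral v u a)"
proof (rule regulated_on_uniform_approx)
  fix e :: real assume "e > 0"
  show "\<exists>w. regulated_on a b w \<and> (\<forall>s\<in>{a..b}. \<bar>KHS_integral v u a s - w s\<bar> \<le> e)"
    by (rule KHS_integral_step_approx[OF u ab M(2) \<open>e > 0\<close>]) (use M in blast)
qed

text \<open>Three-epsilon argument with the same \<open>J\<close> for \<open>v\<close> and every
  \<open>V n\<close>; the common variation bound \<open>M\<close> takes the place of a dominating
  function.\<close>

lemma KHS_integral_tendsto:
  assumes u: "regulated_on a b u" and t: "t \<in> {a..b}" and M: "0 \<le> M"
    and V: "\<And>n. total_variation a b (V n) \<le> ennreal M" "\<And>n. V n a = 0"
    and v: "total_variation a b v \<le> ennreal M" "v a = 0"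
    and lim: "\<And>s. s \<in> {a..b} \<Longrightarrow> (\<lambda>n. V n s) \<longlonglongrightarrow> v s"
  shows "(\<lambda>n. KHS_integral (V n) u a t) \<longlonglongrightarrow> KHS_integral v u a t"
  unfolding LIMSEQ_iff
proof (intro allI impI)
  fix e :: real assume "e > 0"
  then have e: "e / 3 > 0" by simp
  have ab: "a \<le> b" using t by simp
  obtain J where J: "\<And>v. total_variation a b v \<le> ennreal M \<Longrightarrow> v a = 0 \<Longrightarrow> \<bar>KHS_integral v u a t - J v t\<bar> \<le> e / 3"
    and lim_J: "(\<lambda>n. J (V n) t) \<longlonglongrightarrow> J v t"
    by (rule KHS_integral_step_approx[OF u ab M e]) (use t lim in blast)
  obtain N where N: "\<And>n. n \<ge> N \<Longrightarrow> \<bar>J (V n) t - J v t\<bar> < e / 3"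
    using lim_J[unfolded LIMSEQ_iff, rule_format, OF e] unfolding real_norm_def by blast
  have "\<bar>KHS_integral (V n) u a t - KHS_integral v u a t\<bar> < e" if "n \<ge> N" for n
    using J[OF V(1) V(2), of n] J[OF v] N[OF that] by linarith
  then show "\<exists>N. \<forall>n\<ge>N. norm (KHS_integral (V n) u a t - KHS_integral v u a t) < e" by auto
qed

section \<open>Causal operators\<close>

text \<open>The properties of \<open>N\<close> on which the existence proof rests. Bound and
  continuity concern continuous arguments only, because all iterates and the limit are
  continuous.\<close>

locale causal_operator =
  fixes N :: "real \<Rightarrow> (real \<Rightarrow> real) \<Rightarrow> real" and K H :: real
  assumes K: "0 \<le> K" and H: "0 \<le> H"
    and causal: "\<And>t x y. t \<in> {0..1} \<Longrightarrow> (\<And>s. s \<in> {0..t} \<Longrightarrow> x s = y s) \<Longrightarrow> N t x = N t y"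
    and N_integrable: "\<And>x. continuous_on {0..1} x \<Longrightarrow> (\<lambda>t. N t x) integrable_on {0..1}"
    and N_bound: "\<And>t x R. t \<in> {0..1} \<Longrightarrow> continuous_on {0..1} x \<Longrightarrow> 0 \<le> R \<Longrightarrow>
      (\<And>s. s \<in> {0..1} \<Longrightarrow> \<bar>x s\<bar> \<le> R) \<Longrightarrow> \<bar>N t x\<bar> \<le> K * R + H"
    and N_tendsto: "\<And>t X x R. t \<in> {0..1} \<Longrightarrow> (\<And>n. continuous_on {0..1} (X n)) \<Longrightarrow> continuous_on {0..1} x \<Longrightarrow>
      (\<And>n s. s \<in> {0..1} \<Longrightarrow> \<bar>X n s\<bar> \<le> R) \<Longrightarrow> (\<And>s. s \<in> {0..1} \<Longrightarrow> (\<lambda>n. X n s) \<longlonglongrightarrow> x s) \<Longrightarrow>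
      (\<lambda>n. N t (X n)) \<longlonglongrightarrow> N t x"
begin

text \<open>The clipping keeps the map nonexpansive on the whole line and, for
  \<open>\<delta> \<ge> 0\<close>, its values in \<open>{0..1}\<close>. It is 0 up to time
  \<open>\<delta>\<close>, which starts the iteration.\<close>

definition delayed :: "real \<Rightarrow> real \<Rightarrow> real" where
  "delayed \<delta> t = max 0 (min 1 t - \<delta>)"

lemma delayed_bounds: "0 \<le> \<delta> \<Longrightarrow> 0 \<le> delayed \<delta> t" "0 \<le> \<delta> \<Longrightarrow> delayed \<delta> t \<le> 1"
  "0 \<le> \<delta> \<Longrightarrow> t \<in> {0..1} \<Longrightarrow> delayed \<delta> t \<le> t" "0 \<le> \<delta> \<Longrightarrow> t \<in> {0..1} \<Longrightarrow> t - \<delta> \<le> delayed \<delta> t"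
  by (auto simp: delayed_def)

lemma delayed_diff: "\<bar>delayed \<delta> s - delayed \<delta> t\<bar> \<le> \<bar>s - t\<bar>"
  by (auto simp: delayed_def max_def min_def)

text \<open>The displacement caused by the slope \<open>c - N s x\<close>, where \<open>c\<close> is
  the shooting parameter, the prospective \<open>Dx 0\<close>.\<close>

definition shoot :: "real \<Rightarrow> (real \<Rightarrow> real) \<Rightarrow> real \<Rightarrow> real" where
  "shoot c x t = integral {0..t} (\<lambda>s. c - N s x)"

lemma shoot_integrand_integrable:
  assumes "continuous_on {0..1} x" "0 \<le> a" "b \<le> 1"
  shows "(\<lambda>s. c - N s x) integrable_on {a..b}"
  by (rule integrable_on_subinterval[of _ "{0..1}"])
    (use assms in \<open>auto intro!: integrable_diff N_integrable\<close>)

text \<open>The slope is bounded by \<open>N_bound\<close>. The Lipschitz constant depends on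
  \<open>x\<close> through \<open>R\<close> only, which later gives equicontinuity.\<close>

lemma shoot_diff:
  assumes x: "continuous_on {0..1} x" "\<And>s. s \<in> {0..1} \<Longrightarrow> \<bar>x s\<bar> \<le> R" "0 \<le> R"
    and st: "s \<in> {0..1}" "t \<in> {0..1}"
  shows "\<bar>shoot c x s - shoot c x t\<bar> \<le> (\<bar>c\<bar> + K * R + H) * \<bar>s - t\<bar>"
proof -
  have *: "\<bar>shoot c x s - shoot c x t\<bar> \<le> (\<bar>c\<bar> + K * R + H) * \<bar>s - t\<bar>"
    if "0 \<le> t" "t \<le> s" "s \<le> 1" for s t
  proof -
    have "shoot c x t + integral {t..s} (\<lambda>r. c - N r x) = shoot c x s"
      unfolding shoot_def
      by (rule Henstock_Kurzweil_Integration.integral_combine)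
        (use that x in \<open>auto intro!: shoot_integrand_integrable\<close>)
    moreover have "norm (integral {t..s} (\<lambda>r. c - N r x)) \<le> integral {t..s} (\<lambda>r. \<bar>c\<bar> + K * R + H)"
    proof (rule Henstock_Kurzweil_Integration.integral_norm_bound_integral)
      fix r assume "r \<in> {t..s}"
      then have "\<bar>N r x\<bar> \<le> K * R + H"
        using that x by (intro N_bound) auto
      then show "norm (c - N r x) \<le> \<bar>c\<bar> + K * R + H" by simp
    qed (use that x in \<open>auto intro!: shoot_integrand_integrable\<close>)
    ultimately show ?thesis using that by (simp add: mult.commute)
  qed
  show ?thesis
    using *[of s t] *[of t s] st by (cases "s \<le> t") (auto simp: abs_minus_commute)
qed

lemma shoot_0: "shoot c x 0 = 0"
  by (simp add: shoot_def)

lemma shoot_cong: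
  assumes "t \<in> {0..1}" "\<And>s. s \<in> {0..t} \<Longrightarrow> x s = y s"
  shows "shoot c x t = shoot c y t"
  unfolding shoot_def by (rule integral_cong) (use assms in \<open>auto intro!: causal\<close>)

text \<open>Dominated convergence; the bounds \<open>C\<close> and \<open>R\<close> provide a
  constant majorant of the slopes.\<close>

lemma shoot_tendsto:
  assumes t: "t \<in> {0..1}" and X: "\<And>n. continuous_on {0..1} (X n)" "continuous_on {0..1} x"
    and R: "\<And>n s. s \<in> {0..1} \<Longrightarrow> \<bar>X n s\<bar> \<le> R" "0 \<le> R"
    and lim: "\<And>s. s \<in> {0..1} \<Longrightarrow> (\<lambda>n. X n s) \<longlonglongrightarrow> x s"
    and c: "c \<longlonglongrightarrow> c0" "\<And>n. \<bar>c n\<bar> \<le> C"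
  shows "(\<lambda>n. shoot (c n) (X n) t) \<longlonglongrightarrow> shoot c0 x t"
  unfolding shoot_def
proof (rule Equivalence_Lebesgue_Henstock_Integration.dominated_convergence(2))
  show "(\<lambda>s. c n - N s (X n)) integrable_on {0..t}" for n
    using t X by (intro shoot_integrand_integrable) auto
  show "(\<lambda>s. C + (K * R + H)) integrable_on {0..t}"
    using integrable_const[of _ 0 t] by simp
next
  fix n s assume "s \<in> {0..t}"
  then have "\<bar>N s (X n)\<bar> \<le> K * R + H" using t X R by (intro N_bound) auto
  then show "norm (c n - N s (X n)) \<le> C + (K * R + H)" using c(2)[of n] by simp
next
  fix s assume "s \<in> {0..t}"
  then have "(\<lambda>n. N s (X n)) \<longlonglongrightarrow> N s x" using t X R lim by (intro N_tendsto) auto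
  then show "(\<lambda>n. c n - N s (X n)) \<longlonglongrightarrow> c0 - N s x" by (intro tendsto_diff c)
qed

section \<open>The delayed equation and its iteration\<close>

primrec tonelli :: "real \<Rightarrow> real \<Rightarrow> real \<Rightarrow> nat \<Rightarrow> real \<Rightarrow> real" where
  "tonelli \<beta> \<delta> c 0 = (\<lambda>t. \<beta> * c)"
| "tonelli \<beta> \<delta> c (Suc j) = (\<lambda>t. \<beta> * c + shoot c (tonelli \<beta> \<delta> c j) (delayed \<delta> t))"

text \<open>The condition on \<open>R\<close> makes the ball of radius \<open>R\<close> invariant:
  the start is at most \<open>\<bar>\<beta>\<bar> * C\<close>, and the slope, at most
  \<open>C + K * R + H\<close>, acts for time at most 1.\<close>

lemma tonelli_continuous_bound:
  assumes "0 \<le> \<delta>" "\<bar>c\<bar> \<le> C" "0 \<le> R" "(\<bar>\<beta>\<bar> + 1) * C + K * R + H \<le> R"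
  shows "continuous_on {0..1} (tonelli \<beta> \<delta> c j) \<and> (\<forall>t\<in>{0..1}. \<bar>tonelli \<beta> \<delta> c j t\<bar> \<le> R)"
proof (induction j)
  case 0
  have "\<bar>\<beta>\<bar> * \<bar>c\<bar> \<le> (\<bar>\<beta>\<bar> + 1) * C" using assms by (intro mult_mono) auto
  moreover have "0 \<le> K * R" using K assms(3) by simp
  ultimately have "\<bar>\<beta>\<bar> * \<bar>c\<bar> \<le> R" using assms H by linarith
  then show ?case by (auto simp: abs_mult)
next
  case (Suc j)
  let ?x = "tonelli \<beta> \<delta> c j"
  have L: "\<bar>shoot c ?x (delayed \<delta> s) - shoot c ?x (delayed \<delta> t)\<bar> \<le> (\<bar>c\<bar> + K * R + H) * \<bar>s - t\<bar>" for s t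
  proof -
    have "\<bar>shoot c ?x (delayed \<delta> s) - shoot c ?x (delayed \<delta> t)\<bar>
        \<le> (\<bar>c\<bar> + K * R + H) * \<bar>delayed \<delta> s - delayed \<delta> t\<bar>"
      by (rule shoot_diff) (use Suc assms delayed_bounds in auto)
    also have "\<dots> \<le> (\<bar>c\<bar> + K * R + H) * \<bar>s - t\<bar>"
      using delayed_diff K H assms(3) by (intro mult_left_mono) auto
    finally show ?thesis .
  qed
  have "(\<bar>c\<bar> + K * R + H)-lipschitz_on {0..1} (tonelli \<beta> \<delta> c (Suc j))"
    using L K H assms(3) by (intro lipschitz_onI) (auto simp: dist_real_def)
  then have "continuous_on {0..1} (tonelli \<beta> \<delta> c (Suc j))"
    by (rule lipschitz_on_continuous_on)
  moreover have "\<bar>tonelli \<beta> \<delta> c (Suc j) t\<bar> \<le> R" if "t \<in> {0..1}" for t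
  proof -
    have "\<bar>shoot c ?x (delayed \<delta> t)\<bar> \<le> (\<bar>c\<bar> + K * R + H) * \<bar>t - 0\<bar>"
      using L[of t 0] assms(1) by (simp add: delayed_def shoot_0)
    also have "\<dots> \<le> (\<bar>c\<bar> + K * R + H) * 1"
      using that K H assms(3) by (intro mult_left_mono) auto
    finally have "\<bar>tonelli \<beta> \<delta> c (Suc j) t\<bar> \<le> \<bar>\<beta> * c\<bar> + (\<bar>c\<bar> + K * R + H)" by simp
    also have "\<bar>\<beta> * c\<bar> \<le> \<bar>\<beta>\<bar> * C" using assms(2) by (simp add: abs_mult mult_left_mono)
    also have "\<bar>\<beta>\<bar> * C + (\<bar>c\<bar> + K * R + H) \<le> (\<bar>\<beta>\<bar> + 1) * C + K * R + H"
      using assms(2) by (simp add: algebra_simps)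
    finally show ?thesis using assms(4) by simp
  qed
  ultimately show ?case by blast
qed

text \<open>Each iteration settles a further stretch of length \<open>\<delta>\<close>, because the
  value at \<open>t\<close> consults the previous iterate only up to the delayed time. On the first
  stretch that time is 0, where \<open>shoot\<close> vanishes.\<close>

lemma tonelli_stable:
  assumes "0 \<le> \<delta>" "t \<in> {0..1}" "t \<le> real (Suc j) * \<delta>"
  shows "tonelli \<beta> \<delta> c (Suc j) t = tonelli \<beta> \<delta> c j t"
  using assms(2,3)
proof (induction j arbitrary: t)
  case 0
  then have "delayed \<delta> t = 0" by (simp add: delayed_def)
  then show ?case by (simp add: shoot_0)
next
  case (Suc j)
  have "delayed \<delta> t \<le> real (Suc j) * \<delta>"
    using Suc.prems assms(1) by (auto simp: delayed_def algebra_simps)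
  then have "shoot c (tonelli \<beta> \<delta> c (Suc j)) (delayed \<delta> t) = shoot c (tonelli \<beta> \<delta> c j) (delayed \<delta> t)"
    using delayed_bounds[OF assms(1), of t] Suc.prems by (intro shoot_cong Suc.IH) auto
  then show ?case by (simp only: tonelli.simps)
qed

lemma tonelli_tendsto:
  assumes "0 \<le> \<delta>" "\<And>n. \<bar>c n\<bar> \<le> C" "0 \<le> R" "(\<bar>\<beta>\<bar> + 1) * C + K * R + H \<le> R"
    and c: "c \<longlonglongrightarrow> c0" and t: "t \<in> {0..1}"
  shows "(\<lambda>n. tonelli \<beta> \<delta> (c n) j t) \<longlonglongrightarrow> tonelli \<beta> \<delta> c0 j t"
  using t
proof (induction j arbitrary: t)
  case 0
  then show ?case using c by (auto intro!: tendsto_intros)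
next
  case (Suc j)
  have c0: "\<bar>c0\<bar> \<le> C"
    using tendsto_rabs[OF c] assms(2) by (rule LIMSEQ_le_const2[OF _ exI, rule_format])
  have bnd: "continuous_on {0..1} (tonelli \<beta> \<delta> c j)" "s \<in> {0..1} \<Longrightarrow> \<bar>tonelli \<beta> \<delta> c j s\<bar> \<le> R"
    if "\<bar>c\<bar> \<le> C" for c s
    using tonelli_continuous_bound[OF assms(1) that assms(3,4)] by auto
  have "(\<lambda>n. shoot (c n) (tonelli \<beta> \<delta> (c n) j) (delayed \<delta> t)) \<longlonglongrightarrow>
      shoot c0 (tonelli \<beta> \<delta> c0 j) (delayed \<delta> t)"
    by (rule shoot_tendsto[where C = C and R = R])
      (use delayed_bounds[OF assms(1)] assms Suc.IH c0 bnd in auto)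
  then show ?case using c by (auto intro!: tendsto_intros)
qed

text \<open>The boundary condition is the fixed point equation \<open>c = \<Phi> c\<close>. As
  \<open>K * R + H \<le> C\<close>, the continuous \<open>\<Phi>\<close> maps \<open>{-C..C}\<close>
  into itself, and the intermediate value theorem applies to \<open>c - \<Phi> c\<close>.\<close>

lemma delayed_solution_exists:
  assumes "0 < \<delta>" "0 \<le> C" "0 \<le> R" "(\<bar>\<beta>\<bar> + 1) * C + K * R + H \<le> R" "K * R + H \<le> C"
    and eta: "\<eta> \<in> {0..1}"
  shows "\<exists>c x. \<bar>c\<bar> \<le> C \<and> continuous_on {0..1} x \<and> (\<forall>t\<in>{0..1}. \<bar>x t\<bar> \<le> R) \<and>
    (\<forall>t\<in>{0..1}. x t = \<beta> * c + shoot c x (delayed \<delta> t)) \<and> 2 * c = N 1 x + N \<eta> x"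
proof -
  \<comment> \<open>Large enough for stability to reach all of \<open>{0..1}\<close>, so that
    iterate \<open>j\<close> solves the delayed equation exactly.\<close>
  obtain j :: nat where "1 < real j * \<delta>"
    using reals_Archimedean3[OF assms(1)] by blast
  then have j: "1 \<le> real (Suc j) * \<delta>" using assms(1) by (simp add: algebra_simps)
  let ?X = "\<lambda>c. tonelli \<beta> \<delta> c j"
  have bnd: "continuous_on {0..1} (?X c) \<and> (\<forall>t\<in>{0..1}. \<bar>?X c t\<bar> \<le> R)" if "\<bar>c\<bar> \<le> C" for c
    using assms that by (intro tonelli_continuous_bound[of \<delta> c C]) auto
  define \<Phi> where "\<Phi> c = (N 1 (?X c) + N \<eta> (?X c)) / 2" for c
  have \<Phi>_bound: "\<bar>\<Phi> c\<bar> \<le> C" if "\<bar>c\<bar> \<le> C" for c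
  proof -
    have "\<bar>N t (?X c)\<bar> \<le> K * R + H" if "t \<in> {0..1}" for t
      using bnd[OF \<open>\<bar>c\<bar> \<le> C\<close>] that assms by (intro N_bound) auto
    from this[of 1] this[OF eta] show ?thesis using assms(5) unfolding \<Phi>_def by simp
  qed
  have "continuous_on {-C..C} (\<lambda>c. c - \<Phi> c)"
    unfolding continuous_on_sequentially
  proof (intro allI ballI impI)
    fix c :: "nat \<Rightarrow> real" and c0 assume "c0 \<in> {-C..C}" and c: "(\<forall>n. c n \<in> {-C..C}) \<and> c \<longlonglongrightarrow> c0"
    then have ab: "\<bar>c0\<bar> \<le> C" "\<And>n. \<bar>c n\<bar> \<le> C" by (auto simp: abs_le_iff minus_le_iff)
    have "(\<lambda>n. N t (?X (c n))) \<longlonglongrightarrow> N t (?X c0)" if "t \<in> {0..1}" for t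
    proof (rule N_tendsto[OF that, where R = R])
      show "(\<lambda>n. ?X (c n) s) \<longlonglongrightarrow> ?X c0 s" if "s \<in> {0..1}" for s
        by (rule tonelli_tendsto[where C = C and R = R]) (use assms c ab that in auto)
    qed (use bnd ab in auto)
    from this[of 1] this[OF eta] c show "((\<lambda>c. c - \<Phi> c) \<circ> c) \<longlonglongrightarrow> c0 - \<Phi> c0"
      unfolding \<Phi>_def o_def by (intro tendsto_intros) auto
  qed
  moreover have "- C \<le> \<Phi> (- C)" "\<Phi> C \<le> C"
    using \<Phi>_bound[of C] \<Phi>_bound[of "-C"] assms(2) by (auto simp: abs_le_iff)
  ultimately obtain c where c: "-C \<le> c" "c \<le> C" "c - \<Phi> c = 0"
    using IVT'[of "\<lambda>c. c - \<Phi> c" "-C" 0 C] assms(2) by auto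
  have "?X c t = \<beta> * c + shoot c (?X c) (delayed \<delta> t)" if "t \<in> {0..1}" for t
    using tonelli_stable[of \<delta> t j \<beta> c] that j assms(1) by simp
  moreover have "\<bar>c\<bar> \<le> C" using c by simp
  moreover have "2 * c = N 1 (?X c) + N \<eta> (?X c)" using c(3) by (simp add: \<Phi>_def)
  ultimately show ?thesis using bnd by blast
qed

theorem shooting_solution_exists:
  assumes small: "(\<bar>\<beta>\<bar> + 2) * K < 1" and eta: "\<eta> \<in> {0..1}"
  shows "\<exists>c x. continuous_on {0..1} x \<and>
    (\<forall>t\<in>{0..1}. x t = \<beta> * c + integral {0..t} (\<lambda>s. c - N s x)) \<and> 2 * c = N 1 x + N \<eta> x"
proof -
  \<comment> \<open>The a priori bounds \<open>C\<close> for \<open>c\<close> and \<open>R\<close> for \<open>x\<close> solve the linear system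
    \<open>K * R + H = C\<close> and \<open>(\<bar>\<beta>\<bar> + 1) * C + K * R + H = R\<close>.\<close>
  define C where "C = H / (1 - (\<bar>\<beta>\<bar> + 2) * K)"
  define R where "R = ((\<bar>\<beta>\<bar> + 1) * C + H) / (1 - K)"
  have "K \<le> (\<bar>\<beta>\<bar> + 2) * K" using K by (simp add: algebra_simps)
  then have K1: "K < 1" using small by linarith
  have C0: "0 \<le> C" using H small by (simp add: C_def)
  have R0: "0 \<le> R" using H C0 K1 by (simp add: R_def)
  have R1: "(\<bar>\<beta>\<bar> + 1) * C + H = R * (1 - K)" using K1 by (simp add: R_def)
  have "C * (1 - (\<bar>\<beta>\<bar> + 2) * K) = H" using small by (simp add: C_def)
  then have H_eq: "H = C - (\<bar>\<beta>\<bar> + 2) * (K * C)" by (simp add: algebra_simps)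
  \<comment> \<open>Multiplication by \<open>1 - K\<close> eliminates \<open>R\<close> through
    \<open>R1\<close> and then \<open>H\<close> through \<open>H_eq\<close>; the positive factor is
    cancelled at the end.\<close>
  have "(K * R + H) * (1 - K) = K * (R * (1 - K)) + H * (1 - K)" by (simp add: algebra_simps)
  also have "\<dots> = (\<bar>\<beta>\<bar> + 1) * (K * C) + H" unfolding R1[symmetric] by (simp add: algebra_simps)
  also have "\<dots> = C * (1 - K)" by (subst H_eq) (simp add: algebra_simps)
  finally have "(K * R + H) * (1 - K) = C * (1 - K)" .
  then have R2: "K * R + H = C" using K1 by simp
  have ex: "\<exists>c x. \<bar>c\<bar> \<le> C \<and> continuous_on {0..1} x \<and> (\<forall>t\<in>{0..1}. \<bar>x t\<bar> \<le> R) \<and>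
    (\<forall>t\<in>{0..1}. x t = \<beta> * c + shoot c x (delayed (1 / real (Suc n)) t)) \<and> 2 * c = N 1 x + N \<eta> x" for n
    by (rule delayed_solution_exists) (use C0 R0 R1 R2 eta in \<open>auto simp: algebra_simps\<close>)
  obtain c x where cx: "\<And>n. \<bar>c n\<bar> \<le> C \<and> continuous_on {0..1} (x n) \<and> (\<forall>t\<in>{0..1}. \<bar>x n t\<bar> \<le> R) \<and>
    (\<forall>t\<in>{0..1}. x n t = \<beta> * c n + shoot (c n) (x n) (delayed (1 / real (Suc n)) t)) \<and>
    2 * c n = N 1 (x n) + N \<eta> (x n)"
  proof -
    obtain c where "\<forall>n. \<exists>x. \<bar>c n\<bar> \<le> C \<and> continuous_on {0..1} x \<and> (\<forall>t\<in>{0..1}. \<bar>x t\<bar> \<le> R) \<and>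
      (\<forall>t\<in>{0..1}. x t = \<beta> * c n + shoot (c n) x (delayed (1 / real (Suc n)) t)) \<and> 2 * c n = N 1 x + N \<eta> x"
      using choice[OF allI, OF ex] ..
    from choice[OF this] show thesis using that by blast
  qed
  then have c: "\<And>n. \<bar>c n\<bar> \<le> C" and x: "\<And>n. continuous_on {0..1} (x n)"
    "\<And>n t. t \<in> {0..1} \<Longrightarrow> \<bar>x n t\<bar> \<le> R"
    and eq: "\<And>n t. t \<in> {0..1} \<Longrightarrow> x n t = \<beta> * c n + shoot (c n) (x n) (delayed (1 / real (Suc n)) t)"
    and fp: "\<And>n. 2 * c n = N 1 (x n) + N \<eta> (x n)"
    by blast+
  \<comment> \<open>A Lipschitz constant common to all \<open>n\<close>, since
    \<open>\<bar>c n\<bar> \<le> C\<close>.\<close>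
  define L where "L = C + K * R + H"
  have L0: "0 \<le> L" using C0 K R0 H by (simp add: L_def)
  have lip: "\<bar>shoot (c n) (x n) s - shoot (c n) (x n) t\<bar> \<le> L * \<bar>s - t\<bar>"
    if "s \<in> {0..1}" "t \<in> {0..1}" for n s t
  proof -
    have "\<bar>shoot (c n) (x n) s - shoot (c n) (x n) t\<bar> \<le> (\<bar>c n\<bar> + K * R + H) * \<bar>s - t\<bar>"
      by (rule shoot_diff) (use x R0 that in auto)
    also have "\<dots> \<le> L * \<bar>s - t\<bar>"
      using c[of n] by (intro mult_right_mono) (auto simp: L_def)
    finally show ?thesis .
  qed
  have xlip: "\<bar>x n s - x n t\<bar> \<le> L * \<bar>s - t\<bar>" if "s \<in> {0..1}" "t \<in> {0..1}" for n s t
  proof -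
    have "\<bar>x n s - x n t\<bar> \<le> L * \<bar>delayed (1 / real (Suc n)) s - delayed (1 / real (Suc n)) t\<bar>"
      unfolding eq[OF that(1)] eq[OF that(2)]
      using lip[of "delayed (1 / real (Suc n)) s" "delayed (1 / real (Suc n)) t" n]
        delayed_bounds[of "1 / real (Suc n)"] by simp
    also have "\<dots> \<le> L * \<bar>s - t\<bar>" by (intro mult_left_mono delayed_diff L0)
    finally show ?thesis .
  qed
  \<comment> \<open>Two successive extractions: \<open>r\<close> makes the parameters converge, then
    \<open>q\<close> makes the functions along \<open>r\<close> converge; the composite
    \<open>p\<close> does both.\<close>
  obtain c0 r where r: "strict_mono r" "(c \<circ> r) \<longlonglongrightarrow> c0"
  proof (rule seq_compactE[OF compact_imp_seq_compact[OF compact_Icc]])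
    show "\<forall>n. c n \<in> {- C..C}" using c by (simp add: abs_le_iff minus_le_iff)
  qed (rule that)
  obtain x0 and q :: "nat \<Rightarrow> nat" where x0: "continuous_on {0..1} x0" "strict_mono q"
    and unif: "\<And>e. 0 < e \<Longrightarrow> \<exists>N. \<forall>n t. n \<ge> N \<and> t \<in> {0..1} \<longrightarrow> norm ((x \<circ> r) (q n) t - x0 t) < e"
  proof (rule Arzela_Ascoli[of "{0..1}" "x \<circ> r" R])
    fix t e :: real assume "t \<in> {0..1}" "0 < e"
    show "\<exists>d>0. \<forall>n s. s \<in> {0..1} \<and> norm (t - s) < d \<longrightarrow> norm ((x \<circ> r) n t - (x \<circ> r) n s) < e"
    \<comment> \<open>\<open>L\<close> may be 0, hence the added 1.\<close>
    proof (intro exI[of _ "e / (L + 1)"] conjI allI impI)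
      show "0 < e / (L + 1)" using \<open>0 < e\<close> L0 by simp
      fix n s assume s: "s \<in> {0..1} \<and> norm (t - s) < e / (L + 1)"
      have "\<bar>x (r n) t - x (r n) s\<bar> \<le> L * \<bar>t - s\<bar>" using xlip s \<open>t \<in> {0..1}\<close> by blast
      also have "\<dots> \<le> (L + 1) * \<bar>t - s\<bar>" by (intro mult_right_mono) auto
      also have "\<dots> < e" using s L0 by (simp add: pos_less_divide_eq mult.commute)
      finally show "norm ((x \<circ> r) n t - (x \<circ> r) n s) < e" by simp
    qed
  next
    show "norm ((x \<circ> r) n t) \<le> R" if "t \<in> {0..1}" for n t using x(2)[OF that] by simp
  next
    fix y and q :: "nat \<Rightarrow> nat"
    assume y: "continuous_on {0..1} y" "strict_mono q"
      "\<And>e. 0 < e \<Longrightarrow> \<exists>N. \<forall>n t. N \<le> n \<and> t \<in> {0..1} \<longrightarrow> norm ((x \<circ> r) (q n) t - y t) < e"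
    show thesis by (rule that[OF y(1,2)]) (rule y(3))
  qed (rule compact_Icc)
  define p where "p = r \<circ> q"
  have p: "strict_mono p" using r(1) x0(2) by (simp add: p_def strict_mono_o)
  have cp: "(\<lambda>n. c (p n)) \<longlonglongrightarrow> c0"
    using LIMSEQ_subseq_LIMSEQ[OF r(2) x0(2)] by (simp add: p_def o_def)
  have xp: "(\<lambda>n. x (p n) t) \<longlonglongrightarrow> x0 t" if "t \<in> {0..1}" for t
    unfolding LIMSEQ_iff using unif that by (fastforce simp: p_def)
  have Np: "(\<lambda>n. N t (x (p n))) \<longlonglongrightarrow> N t x0" if "t \<in> {0..1}" for t
    by (rule N_tendsto[OF that, where R = R]) (use x x0 xp in auto)
  have "x0 t = \<beta> * c0 + shoot c0 x0 t" if t: "t \<in> {0..1}" for t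
  proof -
    let ?\<delta> = "\<lambda>n. 1 / real (Suc (p n))"
    have "(\<lambda>n. shoot (c (p n)) (x (p n)) t) \<longlonglongrightarrow> shoot c0 x0 t"
      by (rule shoot_tendsto[where R = R and C = C]) (use t x x0 xp cp c R0 in auto)
    \<comment> \<open>The delay moves the time by at most \<open>?\<delta> n\<close>, so by the
      Lipschitz bound its effect vanishes in the limit.\<close>
    moreover have "(\<lambda>n. shoot (c (p n)) (x (p n)) (delayed (?\<delta> n) t) - shoot (c (p n)) (x (p n)) t) \<longlonglongrightarrow> 0"
    proof (rule Lim_null_comparison)
      show "\<forall>\<^sub>F n in sequentially. norm (shoot (c (p n)) (x (p n)) (delayed (?\<delta> n) t) - shoot (c (p n)) (x (p n)) t) \<le> L * ?\<delta> n"
      proof (intro always_eventually allI)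
        fix n
        have "\<bar>delayed (?\<delta> n) t - t\<bar> \<le> ?\<delta> n"
          using delayed_bounds[of "?\<delta> n" t] t by (auto simp del: of_nat_Suc)
        then have "L * \<bar>delayed (?\<delta> n) t - t\<bar> \<le> L * ?\<delta> n" by (intro mult_left_mono L0)
        then show "norm (shoot (c (p n)) (x (p n)) (delayed (?\<delta> n) t) - shoot (c (p n)) (x (p n)) t) \<le> L * ?\<delta> n"
          using lip[of "delayed (?\<delta> n) t" t "p n"] delayed_bounds[of "?\<delta> n" t] t by (auto simp del: of_nat_Suc)
      qed
      have "(\<lambda>n. L * (1 / real (Suc n))) \<longlonglongrightarrow> L * 0"
        using LIMSEQ_inverse_real_of_nat by (intro tendsto_mult tendsto_const) (simp add: inverse_eq_divide)
      from LIMSEQ_subseq_LIMSEQ[OF this p] show "(\<lambda>n. L * ?\<delta> n) \<longlonglongrightarrow> 0" by (simp add: o_def)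
    qed
    ultimately have "(\<lambda>n. shoot (c (p n)) (x (p n)) (delayed (?\<delta> n) t)) \<longlonglongrightarrow> shoot c0 x0 t"
      by (rule Lim_transform)
    then have "(\<lambda>n. \<beta> * c (p n) + shoot (c (p n)) (x (p n)) (delayed (?\<delta> n) t)) \<longlonglongrightarrow> \<beta> * c0 + shoot c0 x0 t"
      using cp by (intro tendsto_intros)
    then have "(\<lambda>n. x (p n) t) \<longlonglongrightarrow> \<beta> * c0 + shoot c0 x0 t" using eq[OF t] by simp
    then show ?thesis using LIMSEQ_unique xp[OF t] by blast
  qed
  moreover have "2 * c0 = N 1 x0 + N \<eta> x0"
  proof (rule LIMSEQ_unique)
    show "(\<lambda>n. 2 * c (p n)) \<longlonglongrightarrow> 2 * c0" using cp by (intro tendsto_intros)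
    show "(\<lambda>n. 2 * c (p n)) \<longlonglongrightarrow> N 1 x0 + N \<eta> x0"
      unfolding fp using Np eta by (intro tendsto_intros) auto
  qed
  ultimately show ?thesis using x0(1) unfolding shoot_def by blast
qed

end

section \<open>The boundary value problem\<close>

lemma supnorm_le:
  assumes "\<And>s. s \<in> {0..1} \<Longrightarrow> \<bar>x s\<bar> \<le> R"
  shows "supnorm x \<le> R"
  unfolding supnorm_def by (rule cSUP_least) (use assms in auto)

theorem theorem1p1:
  fixes f g :: "real \<Rightarrow> real \<Rightarrow> real" and u k h :: "real \<Rightarrow> real" and \<beta> \<eta> :: real
  assumes u: "u \<in> G01"
    and eta: "\<eta> \<in> {0..1}"
    and H1: "\<And>x. x \<in> G01 \<Longrightarrow> (\<lambda>t. f t (x t)) integrable_on {0..1}"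
    and H2: "\<And>t. t \<in> {0..1} \<Longrightarrow> continuous_on UNIV (f t)"
    and k: "\<And>t. t \<in> {0..1} \<Longrightarrow> 0 \<le> k t" "k integrable_on {0..1}"
    and h: "\<And>t. t \<in> {0..1} \<Longrightarrow> 0 \<le> h t" "h integrable_on {0..1}"
    and H3: "\<And>r x t. r > 0 \<Longrightarrow> x \<in> B r \<Longrightarrow> t \<in> {0..1} \<Longrightarrow>
               - k t * supnorm x - h t \<le> f t (x t) \<and> f t (x t) \<le> k t * supnorm x + h t"
    and H4: "\<And>x. x \<in> G01 \<Longrightarrow> bounded_variation 0 1 (\<lambda>t. g t (x t)) \<and> g 0 (x 0) = 0"
    and H5: "\<And>t. t \<in> {0..1} \<Longrightarrow> continuous_on UNIV (g t)"
    and H6: "\<exists>M>0. \<forall>r>0. \<forall>x\<in>B r. total_variation 0 1 (\<lambda>t. g t (x t)) \<le> ennreal M"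
    and small: "(\<bar>\<beta>\<bar> + 2) * (SUP t\<in>{0..1}. \<bar>integral {0..t} k\<bar>) < 1"
  shows "\<exists>x. bvp_solution f g u \<beta> \<eta> x"
proof -
  obtain M where M: "M > 0" "\<And>r x. r > 0 \<Longrightarrow> x \<in> B r \<Longrightarrow> total_variation 0 1 (\<lambda>t. g t (x t)) \<le> ennreal M"
    using H6 by blast
  have u_reg: "regulated_on 0 1 u" using u by (simp add: G01_def)
  obtain W where W: "\<And>s. s \<in> {0..1} \<Longrightarrow> \<bar>u s\<bar> \<le> W"
    using regulated_on_bounded[OF u_reg zero_le_one] by blast
  define N where "N t x = F_int f t x + G_int g u t x" for t x
  \<comment> \<open>\<open>F\<close> contributes \<open>K * R\<close> and the integral of
    \<open>h\<close> to the bound on \<open>N\<close>. The share of \<open>G\<^sub>u\<close> is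
    \<open>3 * M * \<bar>W\<bar>\<close>, free of \<open>R\<close> because \<open>M\<close> in (H6)
    serves all radii.\<close>
  define K where "K = integral {0..1} k"
  define H where "H = integral {0..1} h + 3 * M * \<bar>W\<bar>"
  have G01: "x \<in> G01" if "continuous_on {0..1} x" for x
    using regulated_on_continuous[OF that] by (simp add: G01_def)
  have f_int: "(\<lambda>s. f s (x s)) integrable_on {0..t}" if "continuous_on {0..1} x" "t \<in> {0..1}" for x t
    by (rule integrable_on_subinterval[OF H1[OF G01[OF that(1)]]]) (use that in auto)
  have f_bound: "\<bar>f t (x t)\<bar> \<le> R * k t + h t"
    if "continuous_on {0..1} x" "t \<in> {0..1}" "\<And>s. s \<in> {0..1} \<Longrightarrow> \<bar>x s\<bar> \<le> R" "0 \<le> R" for x t R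
  proof -
    have sn: "supnorm x \<le> R" by (rule supnorm_le) (use that in auto)
    \<comment> \<open>(H3) asks for a positive radius, and \<open>R\<close> may be 0.\<close>
    then have "x \<in> B (R + 1)" using G01[OF that(1)] by (simp add: B_def)
    then have "\<bar>f t (x t)\<bar> \<le> k t * supnorm x + h t"
      using H3[of "R + 1" x t] that by (simp add: abs_le_iff)
    also have "k t * supnorm x \<le> k t * R"
      using sn k(1)[OF that(2)] by (rule mult_left_mono)
    finally show ?thesis by (simp add: mult.commute)
  qed
  have var: "total_variation 0 1 (\<lambda>t. g t (x t)) \<le> ennreal M" "g 0 (x 0) = 0" if "continuous_on {0..1} x" for x
  proof -
    have "x \<in> B (\<bar>supnorm x\<bar> + 1)" using G01[OF that] by (simp add: B_def)
    then show "total_variation 0 1 (\<lambda>t. g t (x t)) \<le> ennreal M" by (rule M(2)[rotated]) simp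
    show "g 0 (x 0) = 0" using H4[OF G01[OF that]] by simp
  qed
  have M0: "0 \<le> M" using M(1) by simp
  have g_int: "KHS_integrable (\<lambda>s. g s (x s)) u 0 t" if "continuous_on {0..1} x" "t \<in> {0..1}" for x t
    by (rule KHS_integrable_regulated[OF u_reg that(2) var(1)[OF that(1)] M0 var(2)[OF that(1)]])
  have N_reg: "regulated_on 0 1 (\<lambda>t. N t x)" if x: "continuous_on {0..1} x" for x
    unfolding N_def F_int_def G_int_def
  proof (rule regulated_on_add)
    show "regulated_on 0 1 (\<lambda>t. integral {0..t} (\<lambda>s. f s (x s)))"
      by (intro regulated_on_continuous indefinite_integral_continuous_1 H1 G01 x)
    show "regulated_on 0 1 (KHS_integral (\<lambda>s. g s (x s)) u 0)"
      by (rule regulated_on_KHS_integral[OF u_reg zero_le_one var(1)[OF x] M0 var(2)[OF x]])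
  qed
  have Rk: "(\<lambda>s. R * k s) integrable_on {0..1}" for R
    using integrable_cmul[OF k(2), of R] by simp
  have dom: "(\<lambda>s. R * k s + h s) integrable_on {0..t}" if "t \<in> {0..1}" for R t
    by (rule integrable_on_subinterval[of _ "{0..1}"])
      (use that h Rk in \<open>auto intro!: integrable_add\<close>)
  interpret causal_operator N K H
  proof
    show "0 \<le> K" unfolding K_def using k by (intro integral_nonneg) auto
    have "0 \<le> integral {0..1} h" using h by (intro integral_nonneg) auto
    then show "0 \<le> H" using M0 by (simp add: H_def)
    show "N t x = N t y" if "t \<in> {0..1}" "\<And>s. s \<in> {0..t} \<Longrightarrow> x s = y s" for t x y
    proof -
      have "F_int f t x = F_int f t y" unfolding F_int_def by (rule integral_cong) (simp add: that)
      moreover have "G_int g u t x = G_int g u t y" unfolding G_int_def by (rule KHS_integral_cong) (simp add: that)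
      ultimately show ?thesis by (simp add: N_def)
    qed
    show "(\<lambda>t. N t x) integrable_on {0..1}" if "continuous_on {0..1} x" for x
      by (rule regulated_on_integrable[OF N_reg[OF that]]) simp
    show "\<bar>N t x\<bar> \<le> K * R + H"
      if t: "t \<in> {0..1}" and x: "continuous_on {0..1} x" "\<And>s. s \<in> {0..1} \<Longrightarrow> \<bar>x s\<bar> \<le> R" "0 \<le> R" for t x R
    proof -
      have "norm (F_int f t x) \<le> integral {0..t} (\<lambda>s. R * k s + h s)"
        unfolding F_int_def
        by (rule Henstock_Kurzweil_Integration.integral_norm_bound_integral[OF f_int[OF x(1) t] dom[OF t]])
          (use f_bound[OF x(1) _ x(2,3)] t in auto)
      also have "\<dots> \<le> integral {0..1} (\<lambda>s. R * k s + h s)"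
        by (rule integral_subset_le) (use t k h x(3) dom[of t] dom[of 1] in auto)
      also have "\<dots> = integral {0..1} (\<lambda>s. R * k s) + integral {0..1} h"
        by (rule Henstock_Kurzweil_Integration.integral_add[OF Rk h(2)])
      finally have F: "\<bar>F_int f t x\<bar> \<le> K * R + integral {0..1} h"
        by (simp add: K_def mult.commute)
      have "\<bar>G_int g u t x\<bar> \<le> 3 * M * \<bar>W\<bar>"
        unfolding G_int_def
        by (rule KHS_integral_bound[OF t var(1)[OF x(1)] M0 var(2)[OF x(1)]
              has_KHS_integral_KHS_integral[OF g_int[OF x(1) t]] W])
      with F show ?thesis unfolding N_def H_def by linarith
    qed
    show "(\<lambda>n. N t (X n)) \<longlonglongrightarrow> N t x"
      if t: "t \<in> {0..1}" and X: "\<And>n. continuous_on {0..1} (X n)" and x: "continuous_on {0..1} x"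
        and R: "\<And>n s. s \<in> {0..1} \<Longrightarrow> \<bar>X n s\<bar> \<le> R"
        and lim: "\<And>s. s \<in> {0..1} \<Longrightarrow> (\<lambda>n. X n s) \<longlonglongrightarrow> x s" for t X x R
    proof -
      have R0: "0 \<le> R" using R[of 0 0] by simp
      have sub: "s \<in> {0..1}" if "s \<in> {0..t}" for s using that t by auto
      have comp: "(\<lambda>n. \<phi> s (X n s)) \<longlonglongrightarrow> \<phi> s (x s)"
        if "continuous_on UNIV (\<phi> s)" "s \<in> {0..1}" for s and \<phi> :: "real \<Rightarrow> real \<Rightarrow> real"
        by (rule continuous_on_tendsto_compose[OF that(1) lim[OF that(2)]]) auto
      have "(\<lambda>n. F_int f t (X n)) \<longlonglongrightarrow> F_int f t x"
        unfolding F_int_def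
      proof (rule Equivalence_Lebesgue_Henstock_Integration.dominated_convergence(2))
        show "(\<lambda>s. f s (X n s)) integrable_on {0..t}" for n by (rule f_int[OF X t])
        show "(\<lambda>s. R * k s + h s) integrable_on {0..t}" by (rule dom[OF t])
        show "norm (f s (X n s)) \<le> R * k s + h s" if "s \<in> {0..t}" for n s
          using f_bound[OF X sub[OF that] R R0] by simp
        show "(\<lambda>n. f s (X n s)) \<longlonglongrightarrow> f s (x s)" if "s \<in> {0..t}" for s
          by (intro comp H2 sub that)
      qed
      moreover have "(\<lambda>n. G_int g u t (X n)) \<longlonglongrightarrow> G_int g u t x"
        unfolding G_int_def
        by (rule KHS_integral_tendsto[OF u_reg t M0 var(1)[OF X] var(2)[OF X] var(1)[OF x] var(2)[OF x]])
          (intro comp H5)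
      ultimately show ?thesis unfolding N_def by (rule tendsto_add)
    qed
  qed
  \<comment> \<open>\<open>K\<close> is the value at \<open>t = 1\<close> of the function in the
    smallness condition; continuity on a compact interval makes its supremum a genuine upper
    bound.\<close>
  have "K = \<bar>integral {0..1} k\<bar>"
    using K by (simp add: K_def)
  also have "\<dots> \<le> (SUP t\<in>{0..1}. \<bar>integral {0..t} k\<bar>)"
  proof (rule cSUP_upper)
    have "compact ((\<lambda>t. \<bar>integral {0..t} k\<bar>) ` {0..1})"
      by (intro compact_continuous_image continuous_on_rabs indefinite_integral_continuous_1 k compact_Icc)
    then show "bdd_above ((\<lambda>t. \<bar>integral {0..t} k\<bar>) ` {0..1})"
      by (intro bounded_imp_bdd_above compact_imp_bounded)
  qed simp
  finally have "(\<bar>\<beta>\<bar> + 2) * K \<le> (\<bar>\<beta>\<bar> + 2) * (SUP t\<in>{0..1}. \<bar>integral {0..t} k\<bar>)"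
    by (intro mult_left_mono) auto
  then have "(\<bar>\<beta>\<bar> + 2) * K < 1" using small by linarith
  from shooting_solution_exists[OF this eta] obtain c x where x: "continuous_on {0..1} x"
    and eq: "\<And>t. t \<in> {0..1} \<Longrightarrow> x t = \<beta> * c + integral {0..t} (\<lambda>s. c - N s x)"
    and fp: "2 * c = N 1 x + N \<eta> x"
    by blast
  define Dx where "Dx t = c - N t x" for t
  have N0: "N 0 x = 0" by (simp add: N_def F_int_def G_int_def KHS_integral_refl)
  have Dx: "Dx \<in> G01"
    \<comment> \<open>\<open>c - N t x\<close> written as \<open>-1 * (N t x - c)\<close>.\<close>
    using regulated_on_affine[OF N_reg[OF x], of "-1" c] by (simp add: G01_def Dx_def[abs_def])
  have x0: "x 0 = \<beta> * c" using eq[of 0] by simp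
  have "bvp_solution f g u \<beta> \<eta> x"
    unfolding bvp_solution_def
  proof (intro conjI bexI[of _ Dx] ballI G01[OF x] Dx f_int g_int x)
    fix t :: real assume t: "t \<in> {0..1}"
    show "x t = x 0 + integral {0..t} Dx"
      using eq[OF t] x0 by (simp add: Dx_def[abs_def])
    show "Dx t = Dx 0 - F_int f t x - G_int g u t x"
      using N0 by (simp add: Dx_def N_def)
  \<comment> \<open>Since \<open>N 0 x = 0\<close>, \<open>Dx 0 = c\<close>; and \<open>fp\<close>
    states that \<open>Dx 1 + Dx \<eta> = 2 * c - N 1 x - N \<eta> x\<close> vanishes.\<close>
  qed (use N0 fp x0 in \<open>auto simp: Dx_def\<close>)
  then show ?thesis by blast
qed

end
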